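(* Let $n\ge2$, $L\ge1$ be integers and let $c>0$ be real. Put $$f=\max\left\{\frac{22}{5c},1\right\},\qquad T=\frac{5f^2L^2n^2}{2},\qquad N=T\left(\frac{fL-1}{fL}\right)^3-2fLn,$$ and assume that $T$ is an integer. Let $\Phi_1,\dots,\Phi_L$ be the clauses of an instance of Quantum 2-SAT on $n$ qubits with promise gap $c$, and run the Quantum Algorithm on these clauses for $T$ steps. (i) If the instance is a YES instance in which, for a suitable choice of an orthonormal basis for each qubit, every clause is of Type I or Type II, then with probability at least $2/3$ at least $N$ of the $T$ measurement outcomes have value $0$. (ii) If the instance is a NO instance (with no restriction on the form of the clauses), then with probability at most $1/3$ more than $N$ of the $T$ measurement outcomes have value $0$.
   Context: Quantum 2-SAT. There are $n$ qubits. A clause is a rank-one orthogonal projector $\Phi_\alpha=|\phi_\alpha\rangle\langle\phi_\alpha|$ ($|\phi_\alpha\rangle$ a unit vector in the space of two distinct qubits $i,j$ depending on $\alpha$), acting as the identity on all other qubits. Put $H=\sum_{\alpha=1}^L\Phi_\alpha$. In a YES instance there is an $n$-qubit density operator $\rho$ with $\mathrm{tr}[H\rho]=0$; in a NO instance $\mathrm{tr}[H\rho]\ge c$ for every $n$-qubit density operator $\rho$. The number $c>0$ is the promise gap. Clause types. Given an orthonormal basis $\{|0\rangle_i,|1\rangle_i\}$ of $\mathbb{C}^2$ for each qubit $i$, a clause is of Type I if $|\phi_\alpha\rangle=a_\alpha|01\rangle_{i,j}+b_\alpha|10\rangle_{i,j}$ with $a_\alpha,b_\alpha\in\mathbb{C}$,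 and of Type II if $|\phi_\alpha\rangle=|11\rangle_{i,j}$. Quantum Algorithm, run for $T$ steps. The initial state is the maximally mixed state $\mathbb{1}/2^n$. At each step, choose $\alpha\in\{1,\dots,L\}$ uniformly at random (independently of the past) and perform the projective measurement $\{\Phi_\alpha,\mathbb{1}-\Phi_\alpha\}$ on the current state $\rho$. Outcome $1$ occurs with probability $\mathrm{tr}[\Phi_\alpha\rho]$, and the post-measurement state is $\Phi_\alpha\rho\Phi_\alpha/\mathrm{tr}[\Phi_\alpha\rho]$; then one of the two qubits in the support of $\Phi_\alpha$ is chosen uniformly at random and a Haar-random unitary is applied to it (on average, applying to qubit $i$ the map $\Lambda_i(\rho)=\frac{\mathbb{1}_i}{2}\otimes\mathrm{tr}_i[\rho]$). Outcome $0$ occurs with probability $1-\mathrm{tr}[\Phi_\alpha\rho]$, and the state becomes $(\mathbb{1}-\Phi_\alpha)\rho(\mathbb{1}-\Phi_\alpha)/(1-\mathrm{tr}[\Phi_\alpha\rho])$. Each step thus yields one measurement outcome in $\{0,1\}$. *)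

theory Defs
  imports "HOL-Probability.Probability"
begin

text \<open>
  The qubits are the elements of a finite type \<^typ>\<open>'n\<close>.  A computational basis state is a function
  \<^typ>\<open>'n \<Rightarrow> bool\<close> (with \<^term>\<open>False\<close> for 0 and \<^term>\<open>True\<close> for 1), so that operators on \<^typ>\<open>'n\<close>
  qubits are matrices of size \<open>2 ^ CARD('n)\<close>.
\<close>

type_synonym qubit_vec = "complex ^ bool"
type_synonym qubit_op = "complex ^ bool ^ bool"
type_synonym two_qubit_vec = "complex ^ (bool \<times> bool)"
type_synonym two_qubit_op = "complex ^ (bool \<times> bool) ^ (bool \<times> bool)"
type_synonym 'n op = "complex ^ ('n \<Rightarrow> bool) ^ ('n \<Rightarrow> bool)"

definition dagger :: "complex ^ 'm ^ 'k \<Rightarrow> complex ^ 'k ^ 'm" where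
  "dagger A = (\<chi> x y. cnj (A $ y $ x))"

definition cinner_vec :: "complex ^ 'm \<Rightarrow> complex ^ 'm \<Rightarrow> complex" where
  "cinner_vec u v = (\<Sum>x\<in>UNIV. cnj (u $ x) * v $ x)"

definition ketbra :: "complex ^ 'm \<Rightarrow> complex ^ 'm ^ 'm" where
  "ketbra v = (\<chi> x y. v $ x * cnj (v $ y))"

definition tensor :: "qubit_vec \<Rightarrow> qubit_vec \<Rightarrow> two_qubit_vec" where
  "tensor u v = (\<chi> p. u $ fst p * v $ snd p)"

definition unitary :: "complex ^ 'm ^ 'm \<Rightarrow> bool" where
  "unitary U \<longleftrightarrow> dagger U ** U = mat 1 \<and> U ** dagger U = mat 1"

definition density_op :: "complex ^ 'm ^ 'm \<Rightarrow> bool" where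
  "density_op \<rho> \<longleftrightarrow> dagger \<rho> = \<rho> \<and> (\<forall>v. 0 \<le> Re (cinner_vec v (\<rho> *v v))) \<and> trace \<rho> = 1"

text \<open>The case distinction is the tensor product with the identity on all other qubits.\<close>

definition on_qubit :: "'n \<Rightarrow> qubit_op \<Rightarrow> ('n::finite) op" where
  "on_qubit i A = (\<chi> x y. if \<forall>k. k \<noteq> i \<longrightarrow> x k = y k then A $ x i $ y i else 0)"

definition on_qubits :: "'n \<Rightarrow> 'n \<Rightarrow> two_qubit_op \<Rightarrow> ('n::finite) op" where
  "on_qubits i j A =
     (\<chi> x y. if \<forall>k. k \<noteq> i \<and> k \<noteq> j \<longrightarrow> x k = y k then A $ (x i, x j) $ (y i, y j) else 0)"

text \<open>
  A clause is stored as its two qubits together with the projector on these two qubits, not with a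
  vector, since the latter is only determined up to a phase.
\<close>

record 'n clause =
  fst_qubit :: 'n
  snd_qubit :: 'n
  proj :: two_qubit_op

definition is_clause :: "'n clause \<Rightarrow> bool" where
  "is_clause C \<longleftrightarrow> fst_qubit C \<noteq> snd_qubit C \<and> (\<exists>\<phi>. norm \<phi> = 1 \<and> proj C = ketbra \<phi>)"

definition clause_op :: "('n::finite) clause \<Rightarrow> 'n op" where
  "clause_op C = on_qubits (fst_qubit C) (snd_qubit C) (proj C)"

definition hamiltonian :: "(nat \<Rightarrow> ('n::finite) clause) \<Rightarrow> nat \<Rightarrow> 'n op" where
  "hamiltonian C L = (\<Sum>\<alpha>=1..L. clause_op (C \<alpha>))"

definition yes_instance :: "(nat \<Rightarrow> ('n::finite) clause) \<Rightarrow> nat \<Rightarrow> bool" where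
  "yes_instance C L \<longleftrightarrow> (\<exists>\<rho>. density_op \<rho> \<and> trace (hamiltonian C L ** \<rho>) = 0)"

definition no_instance :: "real \<Rightarrow> (nat \<Rightarrow> ('n::finite) clause) \<Rightarrow> nat \<Rightarrow> bool" where
  "no_instance c C L \<longleftrightarrow> (\<forall>\<rho>. density_op \<rho> \<longrightarrow> c \<le> Re (trace (hamiltonian C L ** \<rho>)))"

definition local_bases :: "('n \<Rightarrow> bool \<Rightarrow> qubit_vec) \<Rightarrow> bool" where
  "local_bases B \<longleftrightarrow> (\<forall>i s t. cinner_vec (B i s) (B i t) = (if s = t then 1 else 0))"

definition type_I :: "('n \<Rightarrow> bool \<Rightarrow> qubit_vec) \<Rightarrow> 'n clause \<Rightarrow> bool" where
  "type_I B C \<longleftrightarrow>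
     (let i = fst_qubit C; j = snd_qubit C in
      \<exists>a b. proj C = ketbra (a *s tensor (B i False) (B j True) + b *s tensor (B i True) (B j False)))"

definition type_II :: "('n \<Rightarrow> bool \<Rightarrow> qubit_vec) \<Rightarrow> 'n clause \<Rightarrow> bool" where
  "type_II B C \<longleftrightarrow> proj C = ketbra (tensor (B (fst_qubit C) True) (B (snd_qubit C) True))"

text \<open>
  The Haar probability measure on the unitary group of size 2, as a measure whose underlying space
  is this group (with its Borel sets).
\<close>

definition haar_measure :: "qubit_op measure \<Rightarrow> bool" where
  "haar_measure \<mu> \<longleftrightarrow>
     prob_space \<mu> \<and> sets \<mu> = sets (restrict_space borel {U. unitary U}) \<and>
     (\<forall>V. unitary V \<longrightarrow> distr \<mu> \<mu> (\<lambda>U. V ** U) = \<mu> \<and> distr \<mu> \<mu> (\<lambda>U. U ** V) = \<mu>)"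

text \<open>
  For an outcome of probability 0 the post-measurement state below is 0 (by \<open>1 / 0 = 0\<close>); this branch
  is then never taken.
\<close>

definition outcome1_prob :: "('n::finite) clause \<Rightarrow> 'n op \<Rightarrow> real" where
  "outcome1_prob C \<rho> = Re (trace (clause_op C ** \<rho>))"

definition post1 :: "('n::finite) clause \<Rightarrow> 'n op \<Rightarrow> 'n op" where
  "post1 C \<rho> = (1 / outcome1_prob C \<rho>) *\<^sub>R (clause_op C ** \<rho> ** clause_op C)"

definition post0 :: "('n::finite) clause \<Rightarrow> 'n op \<Rightarrow> 'n op" where
  "post0 C \<rho> =
     (1 / (1 - outcome1_prob C \<rho>)) *\<^sub>R ((mat 1 - clause_op C) ** \<rho> ** (mat 1 - clause_op C))"

definition maximally_mixed :: "('n::finite) op" where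
  "maximally_mixed = mat (1 / 2 ^ CARD('n))"

text \<open>
  \<open>outcomes \<mu> C L t \<rho>\<close> is the joint law of the list of the outcomes of \<open>t\<close> steps of the algorithm
  started in the state \<open>\<rho>\<close>; \<^term>\<open>True\<close> is outcome 1 and \<^term>\<open>False\<close> is outcome 0.
\<close>

primrec outcomes ::
  "qubit_op measure \<Rightarrow> (nat \<Rightarrow> ('n::finite) clause) \<Rightarrow> nat \<Rightarrow> nat \<Rightarrow> 'n op \<Rightarrow> bool list measure" where
  "outcomes \<mu> C L 0 \<rho> = return (count_space UNIV) []"
| "outcomes \<mu> C L (Suc t) \<rho> =
     measure_pmf (pmf_of_set {1..L}) \<bind> (\<lambda>\<alpha>.
     measure_pmf (bernoulli_pmf (outcome1_prob (C \<alpha>) \<rho>)) \<bind> (\<lambda>b.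
       if b then
         measure_pmf (pmf_of_set {fst_qubit (C \<alpha>), snd_qubit (C \<alpha>)}) \<bind> (\<lambda>i.
         \<mu> \<bind> (\<lambda>U.
           distr (outcomes \<mu> C L t (on_qubit i U ** post1 (C \<alpha>) \<rho> ** dagger (on_qubit i U)))
             (count_space UNIV) ((#) True)))
       else
         distr (outcomes \<mu> C L t (post0 (C \<alpha>) \<rho>)) (count_space UNIV) ((#) False)))"

end

(*
  (i) In the given bases let W be the number of ones among the m qubits of a set A that contains
  every qubit of the clauses.  The potential V = 2 m^2 - 2 E (m - W)^2 lies between 0 and 2 m^2.
  A clause of Type I or II is supported on states whose two qubits contain k = 1 or k = 2 ones, so
  it commutes with W and the measurement leaves V unchanged on average.  Given outcome 1,
  resampling one of the two qubits makes W a lazy symmetric walk (k = 1) or lets it drift downwards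
  (k = 2); in both cases V decreases by at least 1.  Hence the expected number of outcomes 1 is at
  most 2 m^2, whatever T is, and Markov's inequality applies.  Of the Haar measure only the
  invariance under the unitary that exchanges the two basis states of a qubit is needed.

  (ii) Whatever the current state is, outcome 1 has probability at least c / L, so the number of
  outcomes 0 has at most the exponential moments of a binomial variable; this gives a Chernoff
  bound.
*)

theory Submission
  imports Defs
begin

section \<open>Linear algebra\<close>

text \<open>The parabola is centred at m, an upper bound of W, so that a downward drift moves away
  from the centre and can only help. The factor 2 makes the unit drop exact for k = 1, where W
  changes by +1 or -1 with probability 1/4 each and the mean square grows by 1/2. A state may be a
  superposition of different weights, so W is kept as an operator and never diagonalised: its bounds
  come from products of commuting projectors, and the drift is an identity between expectations in
  the unnormalised state left by outcome 1. The outcomes are dependent, so both parts are inductions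
  on the number of steps for an arbitrary initial density operator. Markov's inequality asks for 6
  m^2 \<le> T - N. With y = f L one has T - N = (5/2) n^2 (3 y - 3 + 1/y) + 2 y n. This suffices for
  m = n once y \<ge> 2, but is close to (5/2) n^2 + 2 n for y near 1, which can occur only for L =
  1; hence the set A in place of all qubits. In (ii), f c \<ge> 22/5 makes T c / L, a lower bound
  for the expected number of outcomes 1, at least 11 y n^2, against T - N \<le> (17/2) y
  n^2.\<close>

lemma dagger_nth [simp]: "dagger A $ x $ y = cnj (A $ y $ x)"
  by (simp add: dagger_def)

lemma dagger_dagger [simp]: "dagger (dagger A) = A"
  by (simp add: vec_eq_iff)

lemma dagger_mult: "dagger (A ** B) = dagger B ** dagger A"
  by (simp add: vec_eq_iff matrix_matrix_mult_def mult.commute)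

lemma dagger_mat_1 [simp]: "dagger (mat 1) = mat 1"
  by (auto simp add: vec_eq_iff mat_def)

lemma dagger_add: "dagger (A + B) = dagger A + dagger B"
  by (simp add: vec_eq_iff)

lemma dagger_diff: "dagger (A - B) = dagger A - dagger B"
  by (simp add: vec_eq_iff)

lemma dagger_scaleR: "dagger (r *\<^sub>R A) = r *\<^sub>R dagger A"
  by (simp add: vec_eq_iff)

lemma dagger_sum: "dagger (\<Sum>k\<in>S. A k) = (\<Sum>k\<in>S. dagger (A k))"
  by (simp add: vec_eq_iff)

lemma dagger_ketbra [simp]: "dagger (ketbra v) = ketbra v"
  by (simp add: vec_eq_iff ketbra_def)

lemma matrix_add_rdistrib: "(B + C) ** A = B ** A + C ** (A :: complex ^ 'n ^ 'm)"
  by (simp add: vec_eq_iff matrix_matrix_mult_def sum.distrib algebra_simps)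

lemma matrix_sum_ldistrib: "(A :: complex ^ 'n ^ 'm) ** (\<Sum>k\<in>S. B k) = (\<Sum>k\<in>S. A ** B k)"
  by (induction S rule: infinite_finite_induct) (auto simp: matrix_add_ldistrib)

lemma matrix_sum_rdistrib: "(\<Sum>k\<in>S. B k) ** (A :: complex ^ 'n ^ 'm) = (\<Sum>k\<in>S. B k ** A)"
  by (induction S rule: infinite_finite_induct) (auto simp: matrix_add_rdistrib)

lemma trace_scaleR: "trace (r *\<^sub>R A :: complex ^ 'n ^ 'n) = r *\<^sub>R trace A"
  by (simp add: trace_def scaleR_sum_right)

lemma matrix_scaleR_left: "(r *\<^sub>R A) ** B = r *\<^sub>R (A ** B :: complex ^ 'n ^ 'm)"
  by (simp add: vec_eq_iff matrix_matrix_mult_def scaleR_sum_right)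

lemma matrix_scaleR_right: "A ** (r *\<^sub>R B) = r *\<^sub>R (A ** B :: complex ^ 'n ^ 'm)"
  by (simp add: vec_eq_iff matrix_matrix_mult_def scaleR_sum_right)

lemma matrix_diff_ldistrib: "A ** (B - C) = A ** B - A ** (C :: complex ^ 'n ^ 'm)"
  by (simp add: vec_eq_iff matrix_matrix_mult_def sum_subtractf algebra_simps)

lemma matrix_diff_rdistrib: "(B - C) ** A = B ** A - C ** (A :: complex ^ 'n ^ 'm)"
  by (simp add: vec_eq_iff matrix_matrix_mult_def sum_subtractf algebra_simps)

lemmas matrix_simps =
  matrix_add_ldistrib matrix_add_rdistrib matrix_diff_ldistrib matrix_diff_rdistrib
  matrix_scaleR_left matrix_scaleR_right

section \<open>Positive semidefinite matrices and expectations\<close>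

lemma cinner_vec_adjoint: "cinner_vec u (A *v v) = cinner_vec (dagger A *v u) v"
proof -
  have "cinner_vec u (A *v v) = (\<Sum>x\<in>UNIV. \<Sum>y\<in>UNIV. cnj (u $ x) * A $ x $ y * v $ y)"
    by (simp add: cinner_vec_def matrix_vector_mult_def sum_distrib_left mult.assoc cong: sum.cong)
  also have "\<dots> = (\<Sum>y\<in>UNIV. \<Sum>x\<in>UNIV. cnj (u $ x) * A $ x $ y * v $ y)"
    by (rule sum.swap)
  also have "\<dots> = cinner_vec (dagger A *v u) v"
    by (simp add: cinner_vec_def matrix_vector_mult_def sum_distrib_left sum_distrib_right mult_ac)
  finally show ?thesis .
qed

definition psd :: "complex ^ 'm ^ 'm \<Rightarrow> bool" where
  "psd A \<longleftrightarrow> dagger A = A \<and> (\<forall>v. 0 \<le> Re (cinner_vec v (A *v v)))"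

lemma density_op_iff: "density_op \<rho> \<longleftrightarrow> psd \<rho> \<and> trace \<rho> = 1"
  by (auto simp: density_op_def psd_def)

lemma psd_conj: "psd A \<Longrightarrow> psd (X ** A ** dagger X)"
  unfolding psd_def
  by (simp add: dagger_mult matrix_mul_assoc cinner_vec_adjoint[of _ X] matrix_vector_mul_assoc[symmetric])

lemma psd_scaleR: "psd A \<Longrightarrow> 0 \<le> r \<Longrightarrow> psd (r *\<^sub>R A)"
proof -
  have "cinner_vec v ((r *\<^sub>R A) *v v) = r *\<^sub>R cinner_vec v (A *v v)" for v
    by (simp add: cinner_vec_def matrix_vector_mult_def scaleR_sum_right sum_distrib_left)
  then show "psd A \<Longrightarrow> 0 \<le> r \<Longrightarrow> psd (r *\<^sub>R A)"
    by (simp add: psd_def dagger_scaleR)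
qed

lemma psd_trace_nonneg: "0 \<le> Re (trace A)" if "psd A"
proof -
  have "cinner_vec (axis x 1) (A *v axis x 1) = A $ x $ x" for x
  proof -
    have "cinner_vec (axis x 1) (A *v axis x 1) = (\<Sum>y\<in>UNIV. if y = x then (A *v axis x 1) $ x else 0)"
      unfolding cinner_vec_def by (rule sum.cong) (auto simp: axis_def)
    then show ?thesis
      by (simp add: matrix_vector_mult_def axis_def if_distrib[of "(*) _"] cong: if_cong)
  qed
  with that show ?thesis
    by (metis (no_types, lifting) psd_def trace_def Re_sum sum_nonneg)
qed

lemma psd_trace_real: "Im (trace A) = 0" if "psd A"
proof -
  have "cnj (trace A) = trace (dagger A)" by (simp add: trace_def)
  with that show ?thesis by (metis psd_def complex_cnj_cancel_iff cnj.simps(2) equal_neg_zero)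
qed

text \<open>The state \<open>S\<close> may be unnormalised: for \<open>S = F ** \<rho> ** F\<close>
  the value \<open>ex S (mat 1)\<close> is the probability of the outcome, so conditional
  expectations come already weighted and need no division.\<close>

definition ex :: "complex ^ 'm ^ 'm \<Rightarrow> complex ^ 'm ^ 'm \<Rightarrow> real" where
  "ex S X = Re (trace (X ** S))"

lemma ex_add: "ex S (X + Y) = ex S X + ex S Y"
  by (simp add: ex_def matrix_simps trace_add)

lemma ex_double: "ex S (2 * X) = 2 * ex S X" "ex S (X * 2) = 2 * ex S X"
  by (simp_all only: mult_2 mult_2_right ex_add)

lemma ex_diff: "ex S (X - Y) = ex S X - ex S Y"
  by (simp add: ex_def matrix_simps trace_sub)

lemma ex_scaleR: "ex S (r *\<^sub>R X) = r * ex S X"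
  by (simp add: ex_def matrix_simps trace_scaleR)

lemma ex_sum: "ex S (\<Sum>k\<in>K. X k) = (\<Sum>k\<in>K. ex S (X k))"
  by (induction K rule: infinite_finite_induct) (auto simp: ex_add, simp_all add: ex_def trace_def)

lemma ex_scaleR_state: "ex (r *\<^sub>R S) X = r * ex S X"
  by (simp add: ex_def matrix_simps trace_scaleR)

lemma ex_conj: "ex (X ** S ** dagger X) Y = ex S (dagger X ** Y ** X)"
proof -
  have "trace ((Y ** X ** S) ** dagger X) = trace (dagger X ** (Y ** X ** S))"
    by (rule trace_mul_sym)
  then show ?thesis by (simp add: ex_def matrix_mul_assoc)
qed

text \<open>By cyclicity this is the trace of the positive operator
  \<open>Y ** S ** dagger Y\<close>.\<close>

lemma ex_square_nonneg: "0 \<le> ex S (dagger Y ** Y)" if "psd S"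
  using psd_trace_nonneg[OF psd_conj[OF that, of Y]] ex_conj[of Y S "mat 1"]
  by (simp add: ex_def)

lemma ex_projector_nonneg: "0 \<le> ex S P" if "psd S" "dagger P = P" "P ** P = P"
  using ex_square_nonneg[OF that(1), of P] that by simp

lemma ex_projector_le: "ex S P \<le> ex S (mat 1)" if "psd S" "dagger P = P" "P ** P = P"
  using ex_projector_nonneg[OF that(1), of "mat 1 - P"] that
  by (simp add: dagger_diff matrix_simps ex_diff)

section \<open>Operators on one and two qubits\<close>

lemma on_qubit_nth:
  "on_qubit i A $ x $ y = (if \<forall>k. k \<noteq> i \<longrightarrow> x k = y k then A $ x i $ y i else 0)"
  by (simp add: on_qubit_def)

lemma on_qubits_nth:
  "on_qubits i j A $ x $ y =
    (if \<forall>k. k \<noteq> i \<and> k \<noteq> j \<longrightarrow> x k = y k then A $ (x i, x j) $ (y i, y j) else 0)"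
  by (simp add: on_qubits_def)

text \<open>Row \<open>x\<close> of \<open>on_qubit i A\<close> vanishes off the two states that
  agree with \<open>x\<close> outside \<open>i\<close>, so the sum over all basis states collapses
  to a sum over one bit.\<close>

lemma on_qubit_mult_nth:
  "(on_qubit i A ** X) $ x $ y = (\<Sum>s\<in>UNIV. A $ x i $ s * X $ (x(i := s)) $ y)"
proof -
  have "(on_qubit i A ** X) $ x $ y =
      (\<Sum>z\<in>range (\<lambda>s. x(i := s)). A $ x i $ z i * X $ z $ y)"
    unfolding matrix_matrix_mult_def vec_lambda_beta
  proof (rule sum.mono_neutral_cong_right)
    show "\<forall>z\<in>UNIV - range (\<lambda>s. x(i := s)). on_qubit i A $ x $ z * X $ z $ y = 0"
    proof
      fix z assume z: "z \<in> UNIV - range (\<lambda>s. x(i := s))"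
      have "\<not> (\<forall>k. k \<noteq> i \<longrightarrow> x k = z k)"
      proof
        assume "\<forall>k. k \<noteq> i \<longrightarrow> x k = z k"
        then have "z = x(i := z i)" by (auto simp: fun_eq_iff)
        with z show False by blast
      qed
      then show "on_qubit i A $ x $ z * X $ z $ y = 0" by (simp only: on_qubit_nth if_False) simp
    qed
  qed (auto simp: on_qubit_nth)
  also have "\<dots> = (\<Sum>s\<in>UNIV. A $ x i $ s * X $ (x(i := s)) $ y)"
    by (subst sum.reindex) (auto simp: inj_on_def fun_upd_eqD)
  finally show ?thesis .
qed

lemma dagger_on_qubit: "dagger (on_qubit i A) = on_qubit i (dagger A)"
  by (auto simp add: vec_eq_iff on_qubit_nth)

lemma dagger_on_qubits: "dagger (on_qubits i j A) = on_qubits i j (dagger A)"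
  by (auto simp add: vec_eq_iff on_qubits_nth)

lemma mult_on_qubit_nth:
  "(X ** on_qubit i A) $ x $ y = (\<Sum>s\<in>UNIV. X $ x $ (y(i := s)) * A $ s $ y i)"
proof -
  have "X ** on_qubit i A = dagger (on_qubit i (dagger A) ** dagger X)"
    by (simp add: dagger_mult dagger_on_qubit)
  then show ?thesis by (simp add: on_qubit_mult_nth mult.commute)
qed

lemma on_qubit_mat_1 [simp]: "on_qubit i (mat 1) = mat 1"
  by (auto simp: vec_eq_iff on_qubit_nth mat_def)

lemma on_qubit_diff: "on_qubit i (A - B) = on_qubit i A - on_qubit i B"
  by (auto simp: vec_eq_iff on_qubit_nth)

lemma on_qubit_mult: "on_qubit i A ** on_qubit i B = on_qubit i (A ** B)"
proof -
  have "(on_qubit i A ** on_qubit i B) $ x $ y = on_qubit i (A ** B) $ x $ y" for x y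
  proof -
    define c where "c \<longleftrightarrow> (\<forall>k. k \<noteq> i \<longrightarrow> x k = y k)"
    have "(\<forall>k. k \<noteq> i \<longrightarrow> (x(i := a)) k = y k) \<longleftrightarrow> c" for a
      by (auto simp: c_def)
    then show ?thesis
      unfolding on_qubit_mult_nth on_qubit_nth c_def[symmetric]
      by (simp add: matrix_matrix_mult_def)
  qed
  then show ?thesis by (simp add: vec_eq_iff)
qed

lemma on_qubit_commute:
  assumes "i \<noteq> j"
  shows "on_qubit i A ** on_qubit j B = on_qubit j B ** on_qubit i A"
proof -
  have "(on_qubit i A ** on_qubit j B) $ x $ y = (on_qubit j B ** on_qubit i A) $ x $ y" for x y
  proof (cases "\<forall>k. k \<noteq> i \<and> k \<noteq> j \<longrightarrow> x k = y k")
    case True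
    \<comment> \<open>Each of the two sums over a bit keeps a single nonzero term.\<close>
    have "(\<forall>k. k \<noteq> j \<longrightarrow> (x(i := s)) k = y k) \<longleftrightarrow> s = y i"
         "(\<forall>k. k \<noteq> i \<longrightarrow> (x(j := s)) k = y k) \<longleftrightarrow> s = y j" for s
      using True assms by auto
    with assms show ?thesis
      by (simp add: on_qubit_mult_nth on_qubit_nth if_distrib[of "(*) _"] mult.commute cong: if_cong)
  next
    case False
    then obtain k where "k \<noteq> i" "k \<noteq> j" "x k \<noteq> y k" by blast
    then have "\<not> (\<forall>k. k \<noteq> j \<longrightarrow> (x(i := s)) k = y k)" "\<not> (\<forall>k. k \<noteq> i \<longrightarrow> (x(j := s)) k = y k)" for s
      by auto
    then show ?thesis by (simp only: on_qubit_mult_nth on_qubit_nth if_False) simp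
  qed
  then show ?thesis by (simp add: vec_eq_iff)
qed

lemma on_qubit_on_qubits_commute:
  assumes "k \<noteq> i" "k \<noteq> j"
  shows "on_qubit k A ** on_qubits i j B = on_qubits i j B ** on_qubit k A"
proof -
  have "(on_qubit k A ** on_qubits i j B) $ x $ y = (on_qubits i j B ** on_qubit k A) $ x $ y" for x y
  proof (cases "\<forall>l. l \<noteq> i \<and> l \<noteq> j \<and> l \<noteq> k \<longrightarrow> x l = y l")
    case True
    have "(\<forall>l. l \<noteq> i \<and> l \<noteq> j \<longrightarrow> (x(k := s)) l = y l) \<longleftrightarrow> s = y k"
         "(\<forall>l. l \<noteq> i \<and> l \<noteq> j \<longrightarrow> x l = (y(k := s)) l) \<longleftrightarrow> s = x k" for s
      using True assms by auto
    with assms show ?thesis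
      by (simp add: on_qubit_mult_nth mult_on_qubit_nth on_qubits_nth if_distrib[of "(*) _"]
          if_distrib[of "\<lambda>c. c * _"] mult.commute cong: if_cong)
  next
    case False
    then obtain l where "l \<noteq> i" "l \<noteq> j" "l \<noteq> k" "x l \<noteq> y l" by blast
    then have "\<not> (\<forall>l. l \<noteq> i \<and> l \<noteq> j \<longrightarrow> (x(k := s)) l = y l)"
              "\<not> (\<forall>l. l \<noteq> i \<and> l \<noteq> j \<longrightarrow> x l = (y(k := s)) l)" for s
      by auto
    then show ?thesis
      by (simp only: on_qubit_mult_nth mult_on_qubit_nth on_qubits_nth if_False) simp
  qed
  then show ?thesis by (simp add: vec_eq_iff)
qed

lemma on_qubits_mult_nth:
  "(on_qubits i j A ** X) $ x $ y =
    (\<Sum>p\<in>UNIV. A $ (x i, x j) $ p * X $ (x(i := fst p, j := snd p)) $ y)" if "i \<noteq> j"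
proof -
  have "(on_qubits i j A ** X) $ x $ y =
      (\<Sum>z\<in>range (\<lambda>p. x(i := fst p, j := snd p)). A $ (x i, x j) $ (z i, z j) * X $ z $ y)"
    unfolding matrix_matrix_mult_def vec_lambda_beta
  proof (rule sum.mono_neutral_cong_right)
    show "\<forall>z\<in>UNIV - range (\<lambda>p. x(i := fst p, j := snd p)). on_qubits i j A $ x $ z * X $ z $ y = 0"
    proof
      fix z assume z: "z \<in> UNIV - range (\<lambda>p. x(i := fst p, j := snd p))"
      have "\<not> (\<forall>k. k \<noteq> i \<and> k \<noteq> j \<longrightarrow> x k = z k)"
      proof
        assume "\<forall>k. k \<noteq> i \<and> k \<noteq> j \<longrightarrow> x k = z k"
        then have "z = x(i := fst (z i, z j), j := snd (z i, z j))" by (auto simp: fun_eq_iff)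
        with z show False by blast
      qed
      then show "on_qubits i j A $ x $ z * X $ z $ y = 0" by (simp only: on_qubits_nth if_False) simp
    qed
  qed (auto simp: on_qubits_nth)
  also have "\<dots> = (\<Sum>p\<in>UNIV. A $ (x i, x j) $ p * X $ (x(i := fst p, j := snd p)) $ y)"
  proof (subst sum.reindex)
    show "inj (\<lambda>p. x(i := fst p, j := snd p))"
    proof (rule injI)
      fix p q assume "x(i := fst p, j := snd p) = x(i := fst q, j := snd q)"
      then have "(x(i := fst p, j := snd p)) k = (x(i := fst q, j := snd q)) k" for k by simp
      from this[of i] this[of j] that show "p = q" by (simp add: prod_eq_iff)
    qed
  qed (use that in simp)
  finally show ?thesis .
qed

lemma on_qubits_mult:
  "on_qubits i j A ** on_qubits i j B = on_qubits i j (A ** B)" if "i \<noteq> j"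
proof -
  have "(on_qubits i j A ** on_qubits i j B) $ x $ y = on_qubits i j (A ** B) $ x $ y" for x y
  proof -
    define c where "c \<longleftrightarrow> (\<forall>k. k \<noteq> i \<and> k \<noteq> j \<longrightarrow> x k = y k)"
    have "(\<forall>k. k \<noteq> i \<and> k \<noteq> j \<longrightarrow> (x(i := a, j := b)) k = y k) \<longleftrightarrow> c" for a b
      by (auto simp: c_def)
    with that show ?thesis
      unfolding on_qubits_mult_nth[OF that] on_qubits_nth c_def[symmetric]
      by (simp add: matrix_matrix_mult_def)
  qed
  then show ?thesis by (simp add: vec_eq_iff)
qed

text \<open>Contracting \<open>A\<close> with the first index of \<open>B\<close> keeps the product
  in two-qubit form, so statements about a clause reduce to computations with vectors of dimension
  4.\<close>

lemma on_qubit_fst_mult_on_qubits: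
  "on_qubit i A ** on_qubits i j B =
    on_qubits i j (\<chi> p q. \<Sum>s\<in>UNIV. A $ fst p $ s * B $ (s, snd p) $ q)" if "i \<noteq> j"
proof -
  have "(on_qubit i A ** on_qubits i j B) $ x $ y = on_qubits i j (\<chi> p q. \<Sum>s\<in>UNIV. A $ fst p $ s * B $ (s, snd p) $ q) $ x $ y" for x y
  proof -
    define c where "c \<longleftrightarrow> (\<forall>k. k \<noteq> i \<and> k \<noteq> j \<longrightarrow> x k = y k)"
    have "(\<forall>k. k \<noteq> i \<and> k \<noteq> j \<longrightarrow> (x(i := a)) k = y k) \<longleftrightarrow> c" for a
      by (auto simp: c_def)
    with that show ?thesis
      unfolding on_qubit_mult_nth on_qubits_nth c_def[symmetric]
      by (simp)
  qed
  then show ?thesis by (simp add: vec_eq_iff)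
qed

lemma on_qubit_snd_mult_on_qubits:
  "on_qubit j A ** on_qubits i j B =
    on_qubits i j (\<chi> p q. \<Sum>s\<in>UNIV. A $ snd p $ s * B $ (fst p, s) $ q)" if "i \<noteq> j"
proof -
  have "(on_qubit j A ** on_qubits i j B) $ x $ y = on_qubits i j (\<chi> p q. \<Sum>s\<in>UNIV. A $ snd p $ s * B $ (fst p, s) $ q) $ x $ y" for x y
  proof -
    define c where "c \<longleftrightarrow> (\<forall>k. k \<noteq> i \<and> k \<noteq> j \<longrightarrow> x k = y k)"
    have "(\<forall>k. k \<noteq> i \<and> k \<noteq> j \<longrightarrow> (x(j := a)) k = y k) \<longleftrightarrow> c" for a
      by (auto simp: c_def)
    with that show ?thesis
      unfolding on_qubit_mult_nth on_qubits_nth c_def[symmetric]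
      by (simp)
  qed
  then show ?thesis by (simp add: vec_eq_iff)
qed

lemma on_qubits_add: "on_qubits i j (A + B) = on_qubits i j A + on_qubits i j B"
  by (auto simp: vec_eq_iff on_qubits_nth)

lemma on_qubits_scaleR: "on_qubits i j (r *\<^sub>R A) = r *\<^sub>R on_qubits i j A"
  by (auto simp: vec_eq_iff on_qubits_nth)

section \<open>Clause projectors\<close>

lemma ketbra_idem:
  assumes "cinner_vec v v = 1"
  shows "ketbra v ** ketbra v = ketbra v"
proof -
  have "(\<Sum>k\<in>UNIV. v $ x * cnj (v $ k) * (v $ k * cnj (v $ y))) = v $ x * cinner_vec v v * cnj (v $ y)" for x y
    by (simp add: cinner_vec_def sum_distrib_left sum_distrib_right mult_ac)
  with assms show ?thesis
    by (simp add: vec_eq_iff ketbra_def matrix_matrix_mult_def)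
qed

lemma cinner_vec_self: "cinner_vec v v = complex_of_real ((norm v)\<^sup>2)"
proof -
  have "(norm v)\<^sup>2 = (\<Sum>x\<in>UNIV. (norm (v $ x))\<^sup>2)"
    by (simp add: norm_vec_def L2_set_def sum_nonneg)
  then show ?thesis
    by (simp add: cinner_vec_def complex_norm_square mult.commute del: of_real_power)
qed

lemma dagger_clause_op: "is_clause C \<Longrightarrow> dagger (clause_op C) = clause_op C"
  by (auto simp: is_clause_def clause_op_def dagger_on_qubits)

lemma clause_op_idem: "is_clause C \<Longrightarrow> clause_op C ** clause_op C = clause_op C"
  by (auto simp: is_clause_def clause_op_def on_qubits_mult ketbra_idem cinner_vec_self)

section \<open>The potential\<close>

definition outer :: "complex ^ 'm \<Rightarrow> complex ^ 'm \<Rightarrow> complex ^ 'm ^ 'm" where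
  "outer u v = (\<chi> x y. u $ x * cnj (v $ y))"

lemma ketbra_eq_outer: "ketbra v = outer v v"
  by (simp add: ketbra_def outer_def)

lemma dagger_outer: "dagger (outer u v) = outer v u"
  by (simp add: vec_eq_iff outer_def)

lemma outer_mult:
  "cinner_vec v w = (if c then 1 else 0) \<Longrightarrow> outer u v ** outer w z = (if c then outer u z else 0)"
proof -
  assume v: "cinner_vec v w = (if c then 1 else 0)"
  have "(outer u v ** outer w z) $ x $ y = u $ x * cinner_vec v w * cnj (z $ y)" for x y
    by (simp add: outer_def matrix_matrix_mult_def cinner_vec_def sum_distrib_left
        sum_distrib_right mult_ac)
  with v show ?thesis by (simp add: vec_eq_iff outer_def)
qed

definition number_op :: "('n \<Rightarrow> bool \<Rightarrow> qubit_vec) \<Rightarrow> 'n \<Rightarrow> ('n::finite) op" where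
  "number_op B i = on_qubit i (ketbra (B i True))"

definition weight :: "('n \<Rightarrow> bool \<Rightarrow> qubit_vec) \<Rightarrow> 'n set \<Rightarrow> ('n::finite) op" where
  "weight B A = (\<Sum>k\<in>A. number_op B k)"

text \<open>The Pauli X matrix in the basis \<open>B i\<close>.\<close>

definition flip_op :: "('n \<Rightarrow> bool \<Rightarrow> qubit_vec) \<Rightarrow> 'n \<Rightarrow> qubit_op" where
  "flip_op B i = outer (B i False) (B i True) + outer (B i True) (B i False)"

text \<open>The two orthonormal vectors are the columns of a square matrix with a left inverse,
  which is then also a right inverse.\<close>

lemma local_bases_complete:
  assumes "local_bases B"
  shows "ketbra (B i False) + ketbra (B i True) = mat 1"
proof -
  let ?M = "(\<chi> x s. B i s $ x) :: qubit_op"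
  have "dagger ?M ** ?M = mat 1"
    using assms by (auto simp: vec_eq_iff local_bases_def cinner_vec_def matrix_matrix_mult_def mat_def)
  then have "?M ** dagger ?M = mat 1"
    by (simp add: matrix_left_right_inverse)
  moreover have "?M ** dagger ?M = ketbra (B i False) + ketbra (B i True)"
    by (simp add: vec_eq_iff matrix_matrix_mult_def ketbra_def UNIV_bool)
  ultimately show ?thesis by simp
qed

lemma dagger_flip_op: "dagger (flip_op B i) = flip_op B i"
  by (simp add: flip_op_def dagger_add dagger_outer add.commute)

lemma dagger_number_op: "dagger (number_op B i) = number_op B i"
  by (simp add: number_op_def dagger_on_qubit)

lemma number_op_commute: "number_op B i ** number_op B j = number_op B j ** number_op B i"
  by (cases "i = j") (simp_all add: number_op_def on_qubit_commute)

lemma dagger_weight: "dagger (weight B A) = weight B A"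
  by (simp add: weight_def dagger_sum dagger_number_op)

lemma number_op_weight_commute: "number_op B i ** weight B A = weight B A ** number_op B i"
  by (simp add: weight_def matrix_sum_ldistrib matrix_sum_rdistrib number_op_commute[of B i])

lemma on_qubit_weight_commute: "i \<notin> A \<Longrightarrow> on_qubit i U ** weight B A = weight B A ** on_qubit i U"
  unfolding weight_def matrix_sum_ldistrib matrix_sum_rdistrib
  by (intro sum.cong refl) (auto simp: number_op_def intro!: on_qubit_commute)

lemma weight_remove: "i \<in> A \<Longrightarrow> weight B A = weight B (A - {i}) + number_op B i"
  unfolding weight_def by (subst sum.remove[of A i]) (auto simp: add.commute)

context
  fixes B :: "('n::finite) \<Rightarrow> bool \<Rightarrow> qubit_vec"
  assumes B: "local_bases B"
begin

lemma outer_basis_mult: "outer u (B i s) ** outer (B i t) z = (if s = t then outer u z else 0)"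
  using B by (intro outer_mult) (simp add: local_bases_def)

lemma flip_op_flip_op: "flip_op B i ** flip_op B i = mat 1"
  using local_bases_complete[OF B, of i]
  by (simp add: flip_op_def matrix_simps outer_basis_mult ketbra_eq_outer add.commute)

lemma unitary_flip_op: "unitary (flip_op B i)"
  by (simp add: unitary_def dagger_flip_op flip_op_flip_op)

lemma flip_op_number_op:
  "dagger (on_qubit i (flip_op B i)) ** number_op B i ** on_qubit i (flip_op B i) = mat 1 - number_op B i"
proof -
  have "ketbra (B i False) = mat 1 - ketbra (B i True)"
    using local_bases_complete[OF B, of i] by (metis add_diff_cancel_right')
  moreover have "flip_op B i ** ketbra (B i True) ** flip_op B i = ketbra (B i False)"
    by (simp add: flip_op_def matrix_simps outer_basis_mult ketbra_eq_outer)
  ultimately show ?thesis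
    by (simp add: number_op_def dagger_on_qubit dagger_flip_op on_qubit_mult on_qubit_diff)
qed

lemma number_op_idem: "number_op B i ** number_op B i = number_op B i"
  using B by (simp add: number_op_def on_qubit_mult ketbra_idem local_bases_def)

lemma ex_weight_le: "psd S \<Longrightarrow> ex S (weight B A) \<le> real (card A) * ex S (mat 1)"
  unfolding weight_def ex_sum
  by (intro sum_bounded_above ex_projector_le dagger_number_op number_op_idem)

text \<open>Operator form of the fact that the eigenvalues of W lie between 0 and |A|. The square is
  expanded into pairs of qubits; for each pair,
  \<open>number_op B k - number_op B k ** number_op B l\<close> is the product of the commuting
  projectors N_k and 1 - N_l, hence a projector.\<close>

lemma ex_weight_square_le:
  assumes S: "psd S"
  shows "ex S (weight B A ** weight B A) \<le> real (card A) * ex S (weight B A)"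
proof -
  have "ex S (number_op B k ** number_op B l) \<le> ex S (number_op B k)" for k l
  proof -
    let ?P = "number_op B k - number_op B k ** number_op B l"
    have "dagger ?P = ?P"
      by (simp add: dagger_diff dagger_mult dagger_number_op number_op_commute)
    moreover have "?P ** ?P = ?P"
    proof -
      have "number_op B k ** number_op B l ** number_op B k = number_op B k ** number_op B l"
        by (metis number_op_commute number_op_idem matrix_mul_assoc)
      moreover have "number_op B k ** number_op B l ** (number_op B k ** number_op B l)
          = number_op B k ** number_op B l"
        by (metis number_op_commute number_op_idem matrix_mul_assoc)
      ultimately show ?thesis
        by (simp add: matrix_simps matrix_mul_assoc number_op_idem)
    qed
    ultimately show ?thesis
      using ex_projector_nonneg[OF S, of ?P] by (simp add: ex_diff)
  qed
  then have "(\<Sum>l\<in>A. \<Sum>k\<in>A. ex S (number_op B k ** number_op B l)) \<le> (\<Sum>l\<in>A. \<Sum>k\<in>A. ex S (number_op B k))"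
    by (intro sum_mono)
  then show ?thesis
    by (simp add: weight_def matrix_sum_ldistrib matrix_sum_rdistrib ex_sum)
qed

end

text \<open>
  The potential is \<open>2 m\<^sup>2 - 2 (m - W)\<^sup>2\<close>.  The resampled potential is its mean over \<open>W = K\<close> and
  \<open>W = K + 1\<close>: what remains after replacing one qubit by a maximally mixed one, where \<open>K\<close> is the
  weight of the other qubits.
\<close>

definition potential :: "real \<Rightarrow> complex ^ 'm ^ 'm \<Rightarrow> complex ^ 'm ^ 'm" where
  "potential m W = (4 * m) *\<^sub>R W - 2 *\<^sub>R (W ** W)"

definition resampled_potential :: "real \<Rightarrow> complex ^ 'm ^ 'm \<Rightarrow> complex ^ 'm ^ 'm" where
  "resampled_potential m K = (4 * m - 2) *\<^sub>R K - 2 *\<^sub>R (K ** K) + (2 * m - 1) *\<^sub>R mat 1"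

text \<open>W^2 \<le> m W leaves at least 2 m W of 4 m W - 2 W^2.\<close>

lemma ex_potential_nonneg:
  assumes "local_bases B" "psd S"
  shows "0 \<le> ex S (potential (real (card A)) (weight B A))"
proof -
  have "0 \<le> ex S (weight B A)"
    unfolding weight_def ex_sum using assms
    by (intro sum_nonneg ex_projector_nonneg dagger_number_op number_op_idem)
  then have "0 \<le> real (card A) * ex S (weight B A)" by simp
  with ex_weight_square_le[OF assms, of A] show ?thesis
    by (simp add: potential_def ex_diff ex_scaleR)
qed

text \<open>Completing the square: 4 m W - 2 W^2 = 2 m^2 - 2 (W - m)^2.\<close>

lemma ex_potential_le:
  assumes "psd S" "dagger W = W"
  shows "ex S (potential m W) \<le> 2 * m\<^sup>2 * ex S (mat 1)"
proof -
  have "0 \<le> ex S (dagger (W - m *\<^sub>R mat 1) ** (W - m *\<^sub>R mat 1))"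
    by (rule ex_square_nonneg[OF assms(1)])
  then have "0 \<le> ex S (W ** W) - 2 * m * ex S W + m\<^sup>2 * ex S (mat 1)"
    by (simp add: assms dagger_diff dagger_scaleR matrix_simps ex_diff ex_scaleR power2_eq_square)
      (simp add: algebra_simps)
  then show ?thesis
    by (simp add: potential_def ex_diff ex_scaleR)
qed

text \<open>Conjugation by \<open>X\<close> fixes \<open>K\<close> and replaces \<open>N\<close> by
  1 - N, so the two weights are K + N and K + 1 - N. As N^2 = N, their squares add up to 2 K^2 + 2 K
  + 1: the flipped qubit has cancelled.\<close>

lemma potential_flip:
  assumes X: "X ** dagger X = mat 1" "dagger X ** X = mat 1"
    and K: "X ** K = K ** X" and N: "dagger X ** N ** X = mat 1 - N"
    and NK: "N ** K = K ** N" and NN: "N ** N = N"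
  shows "ex S (potential m (K + N)) + ex (X ** S ** dagger X) (potential m (K + N))
    = 2 * ex S (resampled_potential m K)"
proof -
  define W where "W = K + N"
  have K': "dagger X ** K ** X = K"
    by (metis X(2) K matrix_mul_assoc matrix_mul_lid)
  have W': "dagger X ** W ** X = K + (mat 1 - N)"
    by (simp add: W_def matrix_simps K' N)
  have "(dagger X ** W ** X) ** (dagger X ** W ** X) = dagger X ** W ** (X ** dagger X) ** W ** X"
    by (simp add: matrix_mul_assoc)
  then have "dagger X ** (W ** W) ** X = (K + (mat 1 - N)) ** (K + (mat 1 - N))"
    by (simp add: X W' matrix_mul_assoc)
  then have *: "ex (X ** S ** dagger X) (potential m W) =
      4 * m * ex S (K + (mat 1 - N)) - 2 * ex S ((K + (mat 1 - N)) ** (K + (mat 1 - N)))"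
    by (simp add: potential_def ex_diff ex_scaleR ex_conj W')
  show ?thesis
    unfolding W_def[symmetric] * unfolding W_def potential_def resampled_potential_def
    by (simp add: matrix_simps ex_diff ex_add ex_double ex_scaleR NK NN)
      (simp add: algebra_simps)
qed

text \<open>Used for a unitary on one qubit and an observable of the others, which cannot see
  it.\<close>

lemma ex_conj_commute:
  assumes "dagger U ** U = mat 1" "U ** Y = Y ** U"
  shows "ex (U ** S ** dagger U) Y = ex S Y"
  by (metis assms ex_conj matrix_mul_assoc matrix_mul_lid)

lemma resampled_potential_commute:
  "U ** K = K ** U \<Longrightarrow> U ** resampled_potential m K = resampled_potential m K ** U"
  by (simp add: resampled_potential_def matrix_simps) (metis matrix_mul_assoc)

text \<open>\<open>R + N\<close> and \<open>R + N'\<close> are the weights that stay when one or the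
  other clause qubit is resampled. On \<open>S\<close> the number N + N' has the sharp value k and
  may be replaced by k next to \<open>S\<close>; applied twice, this turns 2 N N' into k (k - 1).
  The drift term carries the factor k - 1, so it vanishes for k = 1. The last term is twice the drop
  of the potential because the left side adds both choices of the qubit.\<close>

lemma resampled_potential_clause:
  assumes S: "F ** S = S"
    and N: "N ** N = N" "N' ** N' = N'" "N ** N' = N' ** N" "N ** R = R ** N" "N' ** R = R ** N'"
    and F: "(N + N') ** F = k *\<^sub>R F"
  shows "ex S (resampled_potential m (R + N)) + ex S (resampled_potential m (R + N'))
    = 2 * ex S (potential m (R + N + N')) + 4 * (k - 1) * (ex S R - (m - k) * ex S (mat 1))
      - 2 * ex S (mat 1)"
proof -
  have *: "ex S (Y ** (N + N')) = k * ex S Y" for Y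
  proof -
    have "(N + N') ** S = k *\<^sub>R S"
      by (metis F S matrix_mul_assoc matrix_scaleR_left)
    then have "Y ** (N + N') ** S = k *\<^sub>R (Y ** S)"
      by (simp add: matrix_mul_assoc[symmetric] matrix_scaleR_right)
    then show ?thesis by (simp add: ex_def trace_scaleR)
  qed
  have 1: "ex S N + ex S N' = k * ex S (mat 1)"
    using *[of "mat 1"] by (simp add: ex_add)
  have 2: "ex S (R ** N) + ex S (R ** N') = k * ex S R"
    using *[of R] by (simp add: ex_add matrix_simps)
  have 3: "ex S N + ex S N' + 2 * ex S (N' ** N) = k * (k * ex S (mat 1))"
    using *[of "N + N'"] 1 N by (simp add: ex_add ex_double matrix_simps)
  have "ex S (resampled_potential m (R + N)) + ex S (resampled_potential m (R + N'))
      - 2 * ex S (potential m (R + N + N')) = - 4 * (ex S R)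
      + 4 * (ex S (R ** N) + ex S (R ** N')) - (4 * m + 4) * (ex S N + ex S N')
      + 4 * (ex S N + ex S N' + 2 * ex S (N' ** N)) + (4 * m - 2) * ex S (mat 1)"
    by (simp add: potential_def resampled_potential_def matrix_simps ex_diff ex_add ex_double ex_scaleR N)
      (simp add: algebra_simps ex_double)
  then show ?thesis
    unfolding 3 unfolding 1 2 by (simp add: algebra_simps)
qed

lemma potential_commute:
  "F ** W = W ** F \<Longrightarrow> F ** potential m W = potential m W ** F"
  by (simp add: potential_def matrix_simps) (metis matrix_mul_assoc)

text \<open>Since \<open>Y\<close> commutes with \<open>F\<close>, the cross terms F Y (1 - F)
  vanish, and forgetting the outcome leaves the expectation unchanged.\<close>

lemma ex_measurement:
  assumes F: "dagger F = F" "F ** F = F" and Y: "F ** Y = Y ** F"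
  shows "ex (F ** S ** F) Y + ex ((mat 1 - F) ** S ** (mat 1 - F)) Y = ex S Y"
proof -
  have "ex (F ** S ** dagger F) Y + ex ((mat 1 - F) ** S ** dagger (mat 1 - F)) Y = ex S Y"
  proof -
    have "Y ** F ** F = Y ** F" by (simp add: matrix_mul_assoc[symmetric] F)
    then show ?thesis
      unfolding ex_conj by (simp add: dagger_diff F matrix_simps ex_diff Y)
  qed
  then show ?thesis by (simp add: dagger_diff F)
qed

section \<open>Clauses and measurements\<close>

text \<open>The vector of a clause is an eigenvector of the number of ones on its two qubits: a|01>
  + b|10> with eigenvalue 1, |11> with eigenvalue 2.\<close>

lemma on_qubits_clause_number:
  assumes B: "local_bases B" and C: "is_clause C" and T: "type_I B C \<or> type_II B C"
  defines "i \<equiv> fst_qubit C" and "j \<equiv> snd_qubit C"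
  shows "\<exists>k\<in>{1, 2}. (number_op B i + number_op B j) ** clause_op C = k *\<^sub>R clause_op C"
proof -
  have ij: "i \<noteq> j" using C by (simp add: is_clause_def i_def j_def)
  \<comment> \<open>\<open>fi\<close> and \<open>fj\<close> are the number operators of the two
    qubits, acting on two-qubit vectors. By \<open>ni\<close> and \<open>nj\<close> the products
    with a clause are rank-one operators |fi v><v| and |fj v><v|, so \<open>key\<close> only needs
    the eigenvalue equation for v.\<close>
  define fi where "fi = (\<lambda>v::two_qubit_vec. \<chi> p. \<Sum>s\<in>UNIV. ketbra (B i True) $ fst p $ s * v $ (s, snd p))"
  define fj where "fj = (\<lambda>v::two_qubit_vec. \<chi> p. \<Sum>s\<in>UNIV. ketbra (B j True) $ snd p $ s * v $ (fst p, s))"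
  have ni: "number_op B i ** on_qubits i j (ketbra v) = on_qubits i j (\<chi> p q. fi v $ p * cnj (v $ q))" for v
    unfolding number_op_def on_qubit_fst_mult_on_qubits[OF ij]
    by (simp add: fi_def ketbra_def[of v] sum_distrib_right mult.assoc)
  have nj: "number_op B j ** on_qubits i j (ketbra v) = on_qubits i j (\<chi> p q. fj v $ p * cnj (v $ q))" for v
    unfolding number_op_def on_qubit_snd_mult_on_qubits[OF ij]
    by (simp add: fj_def ketbra_def[of v] sum_distrib_right mult.assoc)
  have fi: "fi (tensor (B i s) u) = (if s then tensor (B i s) u else 0)" for s u
  proof -
    have "fi (tensor (B i s) u) $ p = B i True $ fst p * u $ snd p * cinner_vec (B i True) (B i s)" for p
      by (simp add: fi_def tensor_def ketbra_def cinner_vec_def sum_distrib_left mult_ac)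
    with B show ?thesis by (auto simp: vec_eq_iff tensor_def local_bases_def)
  qed
  have fj: "fj (tensor u (B j s)) = (if s then tensor u (B j s) else 0)" for s u
  proof -
    have "fj (tensor u (B j s)) $ p = B j True $ snd p * u $ fst p * cinner_vec (B j True) (B j s)" for p
      by (simp add: fj_def tensor_def ketbra_def cinner_vec_def sum_distrib_left mult_ac)
    with B show ?thesis by (auto simp: vec_eq_iff tensor_def local_bases_def)
  qed
  have lin: "fi (a *s u + b *s w) = a *s fi u + b *s fi w" "fj (a *s u + b *s w) = a *s fj u + b *s fj w" for a b u w
    by (simp_all add: vec_eq_iff fi_def fj_def sum.distrib sum_distrib_left algebra_simps)
  have key: "(number_op B i + number_op B j) ** clause_op C = k *\<^sub>R clause_op C"
    if "proj C = ketbra v" "fi v + fj v = k *\<^sub>R v" for v k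
  proof -
    have "fi v $ p + fj v $ p = k *\<^sub>R (v $ p)" for p
      using that(2) by (metis vector_add_component vector_scaleR_component)
    then have "(\<chi> p q. fi v $ p * cnj (v $ q)) + (\<chi> p q. fj v $ p * cnj (v $ q)) = k *\<^sub>R ketbra v"
      by (simp add: vec_eq_iff ketbra_def distrib_right[symmetric])
    then show ?thesis
      using that(1) ni[of v] nj[of v]
      by (simp add: clause_op_def matrix_simps i_def j_def on_qubits_add[symmetric] on_qubits_scaleR[symmetric])
  qed
  from T show ?thesis
  proof
    assume "type_I B C"
    then obtain a b where "proj C =
        ketbra (a *s tensor (B i False) (B j True) + b *s tensor (B i True) (B j False))"
      by (auto simp: type_I_def Let_def i_def j_def)
    from key[OF this, of 1] show ?thesis by (simp add: lin fi fj add.commute)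
  next
    assume "type_II B C"
    then have "proj C = ketbra (tensor (B i True) (B j True))"
      by (simp add: type_II_def i_def j_def)
    from key[OF this, of 2] show ?thesis by (simp add: fi fj scaleR_2)
  qed
qed

text \<open>The other |A| - 2 qubits carry at most |A| - 2 ones, so for k = 2 the drift term is
  nonpositive. The summand \<open>ex S (mat 1)\<close> is the probability of outcome 1, so the drop
  is at least 1 per occurrence of this outcome.\<close>

lemma potential_clause_decrease:
  assumes B: "local_bases B" and C: "is_clause C" and T: "type_I B C \<or> type_II B C"
    and A: "fst_qubit C \<in> A" "snd_qubit C \<in> A" and \<rho>: "psd \<rho>"
  defines "i \<equiv> fst_qubit C" and "j \<equiv> snd_qubit C" and "m \<equiv> real (card A)"
    and "F \<equiv> clause_op C"
  defines "S \<equiv> F ** \<rho> ** F"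
  shows "(ex S (resampled_potential m (weight B (A - {i}))) + ex S (resampled_potential m (weight B (A - {j})))) / 2
           + ex S (mat 1) \<le> ex S (potential m (weight B A))" (is "?decr")
    and "F ** potential m (weight B A) = potential m (weight B A) ** F" (is "?comm")
proof -
  have ij: "i \<noteq> j" using C by (simp add: is_clause_def i_def j_def)
  have F: "dagger F = F" "F ** F = F"
    using C by (simp_all add: F_def dagger_clause_op clause_op_idem)
  have S: "psd S"
    using psd_conj[OF \<rho>, of F] F by (simp add: S_def)
  let ?R = "weight B (A - {i} - {j})"
  obtain k where k: "k \<in> {1, 2 :: real}" and Fk: "(number_op B i + number_op B j) ** F = k *\<^sub>R F"
    using on_qubits_clause_number[OF B C T] unfolding F_def i_def j_def by blast
  have wi: "weight B (A - {i}) = ?R + number_op B j"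
    using A ij by (intro weight_remove) (auto simp: j_def)
  have wj: "weight B (A - {j}) = ?R + number_op B i"
  proof -
    have "weight B (A - {j}) = weight B (A - {j} - {i}) + number_op B i"
      using A ij by (intro weight_remove) (auto simp: i_def)
    then show ?thesis by (simp add: insert_commute flip: Diff_insert)
  qed
  have w: "weight B A = ?R + number_op B j + number_op B i"
    using weight_remove[of i A B] A unfolding wi by (simp add: i_def)
  \<comment> \<open>|A| \<ge> 2 makes the truncated subtraction on naturals exact.\<close>
  have card: "real (card (A - {i} - {j})) = m - 2"
  proof -
    have "{i, j} \<subseteq> A" using A by (auto simp: i_def j_def)
    then have "card {i, j} \<le> card A" by (intro card_mono) auto
    moreover have "card (A - {i} - {j}) = card A - 1 - 1"
      using A ij by (simp add: i_def j_def card_Diff_singleton)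
    ultimately show ?thesis using ij by (simp add: m_def)
  qed
  have R: "ex S ?R \<le> (m - 2) * ex S (mat 1)"
    using ex_weight_le[OF B S, of "A - {i} - {j}"] card by simp
  have FS: "F ** S = S"
    by (simp add: S_def matrix_mul_assoc F)
  have "ex S (resampled_potential m (?R + number_op B j)) + ex S (resampled_potential m (?R + number_op B i))
    = 2 * ex S (potential m (?R + number_op B j + number_op B i))
      + 4 * (k - 1) * (ex S ?R - (m - k) * ex S (mat 1)) - 2 * ex S (mat 1)"
    using Fk by (intro resampled_potential_clause[OF FS] number_op_idem[OF B] number_op_commute number_op_weight_commute)
      (simp add: add.commute)
  moreover have "4 * (k - 1) * (ex S ?R - (m - k) * ex S (mat 1)) \<le> 0"
    using k R by auto
  ultimately show ?decr
    unfolding wi wj w by (simp add: field_simps)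
  \<comment> \<open>Adjoints of \<open>Fk\<close>: as k is real, multiplying \<open>F\<close> by the
    number of ones from the right gives the same as from the left.\<close>
  have "dagger ((number_op B i + number_op B j) ** F) = dagger (k *\<^sub>R F)"
    by (simp only: Fk)
  then have "F ** (number_op B i + number_op B j) = k *\<^sub>R F"
    by (simp only: dagger_mult dagger_add dagger_scaleR F dagger_number_op)
  with Fk have QF: "F ** (number_op B i + number_op B j) = (number_op B i + number_op B j) ** F"
    by simp
  have RF: "F ** ?R = ?R ** F"
    unfolding weight_def matrix_sum_ldistrib matrix_sum_rdistrib
    by (intro sum.cong refl)
      (auto simp: F_def clause_op_def number_op_def i_def j_def intro!: on_qubit_on_qubits_commute[symmetric])
  have "weight B A = ?R + (number_op B i + number_op B j)"
    by (simp add: w add_ac)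
  with QF RF show ?comm
    by (intro potential_commute) (simp add: matrix_add_ldistrib matrix_add_rdistrib)
qed

section \<open>Outcome probabilities and post-measurement states\<close>

lemma outcome1_prob_eq: "outcome1_prob C \<rho> = ex \<rho> (clause_op C)"
  by (simp add: outcome1_prob_def ex_def)

lemma outcome1_prob_bounds:
  assumes "is_clause C" "density_op \<rho>"
  shows "0 \<le> outcome1_prob C \<rho>" "outcome1_prob C \<rho> \<le> 1"
  using ex_projector_nonneg[of \<rho> "clause_op C"] ex_projector_le[of \<rho> "clause_op C"] assms
  by (simp_all add: density_op_iff outcome1_prob_eq dagger_clause_op clause_op_idem)
    (simp_all add: ex_def)

text \<open>\<open>ex\<close> sees only the real part of the trace; self-adjointness removes the
  imaginary part.\<close>

lemma psd_trace_eq_1I: "psd A \<Longrightarrow> ex A (mat 1) = 1 \<Longrightarrow> trace A = 1"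
  using psd_trace_real[of A] by (simp add: ex_def complex_eq_iff)

lemma density_op_post1:
  assumes "is_clause C" "density_op \<rho>" "outcome1_prob C \<rho> \<noteq> 0"
  shows "density_op (post1 C \<rho>)"
proof -
  let ?F = "clause_op C"
  have F: "dagger ?F = ?F" "?F ** ?F = ?F"
    using assms by (simp_all add: dagger_clause_op clause_op_idem)
  have "psd (?F ** \<rho> ** dagger ?F)"
    using assms by (intro psd_conj) (simp add: density_op_iff)
  then have "psd (post1 C \<rho>)"
    unfolding post1_def F using outcome1_prob_bounds[OF assms(1,2)] by (intro psd_scaleR) auto
  moreover have "ex (post1 C \<rho>) (mat 1) = 1"
    using ex_conj[of ?F \<rho> "mat 1"] assms(3) F
    by (simp add: post1_def ex_scaleR_state outcome1_prob_eq)
  ultimately show ?thesis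
    by (simp add: density_op_iff psd_trace_eq_1I)
qed

lemma density_op_post0:
  assumes "is_clause C" "density_op \<rho>" "outcome1_prob C \<rho> \<noteq> 1"
  shows "density_op (post0 C \<rho>)"
proof -
  let ?F = "mat 1 - clause_op C"
  have F: "dagger ?F = ?F" "?F ** ?F = ?F"
    using assms by (simp_all add: dagger_diff matrix_simps dagger_clause_op clause_op_idem)
  have "psd (?F ** \<rho> ** dagger ?F)"
    using assms by (intro psd_conj) (simp add: density_op_iff)
  then have "psd (post0 C \<rho>)"
    unfolding post0_def F using outcome1_prob_bounds[OF assms(1,2)] by (intro psd_scaleR) auto
  moreover have "ex (post0 C \<rho>) (mat 1) = 1"
  proof -
    have "ex \<rho> (mat 1) = 1"
      using assms(2) by (simp add: density_op_iff ex_def)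
    then show ?thesis
      using ex_conj[of ?F \<rho> "mat 1"] assms(3) F
      by (simp add: post0_def ex_scaleR_state outcome1_prob_eq ex_diff)
  qed
  ultimately show ?thesis
    by (simp add: density_op_iff psd_trace_eq_1I)
qed

lemma unitary_on_qubit: "unitary U \<Longrightarrow> unitary (on_qubit i U)"
  by (simp add: unitary_def dagger_on_qubit on_qubit_mult)

lemma density_op_unitary:
  assumes "density_op \<rho>" "unitary U"
  shows "density_op (U ** \<rho> ** dagger U)"
  using assms psd_conj[of \<rho> U] trace_mul_sym[of "U ** \<rho>" "dagger U"]
  by (simp add: density_op_iff unitary_def matrix_mul_assoc)

lemma density_op_maximally_mixed: "density_op (maximally_mixed :: ('n::finite) op)"
proof -
  have m: "(maximally_mixed :: 'n op) = (1 / 2 ^ CARD('n)) *\<^sub>R mat 1"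
    by (auto simp: maximally_mixed_def vec_eq_iff mat_def scaleR_conv_of_real[where 'a = complex])
  have "psd (mat 1 :: 'n op)"
    by (simp add: psd_def cinner_vec_self)
  then have "psd (maximally_mixed :: 'n op)"
    unfolding m by (rule psd_scaleR) simp
  moreover have "trace (maximally_mixed :: 'n op) = 1"
    by (simp add: maximally_mixed_def trace_def mat_def card_fun)
  ultimately show ?thesis by (simp add: density_op_iff)
qed

text \<open>The outcome probabilities add up to the energy, so a uniformly chosen clause yields
  outcome 1 with probability at least c / L in every state.\<close>

lemma no_instance_outcome1_prob:
  assumes "no_instance c C L" "density_op \<rho>"
  shows "c \<le> (\<Sum>\<alpha>=1..L. outcome1_prob (C \<alpha>) \<rho>)"
  using assms by (simp add: no_instance_def hamiltonian_def outcome1_prob_eq flip: ex_sum)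
    (simp add: ex_def)

section \<open>The law of the outcomes\<close>

lemma borel_measurable_vec_nth [measurable (raw)]:
  "f \<in> borel_measurable M \<Longrightarrow> (\<lambda>w. f w $ i) \<in> borel_measurable M"
  for f :: "'w \<Rightarrow> 'b::euclidean_space ^ 'n"
  by (erule measurable_compose) (intro borel_measurable_continuous_onI continuous_intros)

lemma borel_measurable_vecI:
  fixes f :: "'w \<Rightarrow> 'b::euclidean_space ^ 'n"
  assumes "\<And>i. (\<lambda>w. f w $ i) \<in> borel_measurable M"
  shows "f \<in> borel_measurable M"
  using assms by (subst borel_measurable_euclidean_space) (auto simp: Basis_vec_def inner_axis)

lemma borel_measurable_matrixI:
  fixes f :: "'w \<Rightarrow> complex ^ 'n ^ 'm"
  assumes "\<And>i j. (\<lambda>w. f w $ i $ j) \<in> borel_measurable M"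
  shows "f \<in> borel_measurable M"
  by (intro borel_measurable_vecI assms)

lemma borel_measurable_matrix_mult [measurable (raw)]:
  fixes f :: "'w \<Rightarrow> complex ^ 'n ^ 'm" and g :: "'w \<Rightarrow> complex ^ 'k ^ 'n"
  assumes [measurable]: "f \<in> borel_measurable M" "g \<in> borel_measurable M"
  shows "(\<lambda>w. f w ** g w) \<in> borel_measurable M"
  by (intro borel_measurable_matrixI) (simp add: matrix_matrix_mult_def)

lemma borel_measurable_dagger [measurable (raw)]:
  fixes f :: "'w \<Rightarrow> complex ^ 'n ^ 'm"
  assumes [measurable]: "f \<in> borel_measurable M"
  shows "(\<lambda>w. dagger (f w)) \<in> borel_measurable M"
proof (intro borel_measurable_matrixI)
  have [measurable]: "cnj \<in> borel_measurable borel"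
    by (intro borel_measurable_continuous_onI continuous_intros)
  show "(\<lambda>w. dagger (f w) $ i $ j) \<in> borel_measurable M" for i j
    by simp
qed

lemma borel_measurable_on_qubit [measurable (raw)]:
  assumes [measurable]: "f \<in> borel_measurable M"
  shows "(\<lambda>w. on_qubit i (f w)) \<in> borel_measurable M"
  by (intro borel_measurable_matrixI) (simp add: on_qubit_nth)

lemma borel_measurable_ex [measurable (raw)]:
  assumes [measurable]: "f \<in> borel_measurable M"
  shows "(\<lambda>w. ex (f w) X) \<in> borel_measurable M"
proof -
  have [measurable]: "Re \<in> borel_measurable borel"
    by (intro borel_measurable_continuous_onI continuous_intros)
  show ?thesis
    by (simp add: ex_def trace_def)
qed

lemma borel_measurable_outcome1_prob [measurable (raw)]:
  "f \<in> borel_measurable M \<Longrightarrow> (\<lambda>w. outcome1_prob C (f w)) \<in> borel_measurable M"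
  by (simp add: outcome1_prob_eq)

lemma borel_measurable_post [measurable (raw)]:
  assumes [measurable]: "f \<in> borel_measurable M"
  shows "(\<lambda>w. post0 C (f w)) \<in> borel_measurable M" "(\<lambda>w. post1 C (f w)) \<in> borel_measurable M"
  by (simp_all add: post0_def post1_def)

text \<open>\<open>bernoulli_pmf\<close> clamps its parameter to [0, 1], which \<open>min\<close>
  and \<open>max\<close> make explicit. Thus the law is measurable on the space of all matrices,
  where \<open>outcome1_prob\<close> may leave this interval.\<close>

lemma measurable_bernoulli_pmf:
  assumes [measurable]: "p \<in> borel_measurable M"
  shows "(\<lambda>w. measure_pmf (bernoulli_pmf (p w))) \<in> M \<rightarrow>\<^sub>M prob_algebra (count_space UNIV)"
proof (intro measurable_prob_algebraI measurable_subprob_algebra)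
  fix A :: "bool set"
  have "emeasure (measure_pmf (bernoulli_pmf (p w))) A =
      (\<Sum>b\<in>A. ennreal (if b then min 1 (max 0 (p w)) else 1 - min 1 (max 0 (p w))))" for w
    by (simp add: emeasure_measure_pmf_finite bernoulli_pmf.rep_eq)
  moreover have "(\<lambda>w. \<Sum>b\<in>A. ennreal (if b then min 1 (max 0 (p w)) else 1 - min 1 (max 0 (p w))))
      \<in> borel_measurable M"
    by measurable
  ultimately show "(\<lambda>w. emeasure (measure_pmf (bernoulli_pmf (p w))) A) \<in> borel_measurable M"
    by (simp only:)
qed (auto intro: measure_pmf.prob_space_axioms prob_space_imp_subprob_space)

lemma measurable_pair_count_space:
  assumes "countable (UNIV :: 'b set)" "\<And>y. (\<lambda>x. g x y) \<in> M \<rightarrow>\<^sub>M K"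
  shows "(\<lambda>(x, y :: 'b). g x y) \<in> M \<Otimes>\<^sub>M count_space UNIV \<rightarrow>\<^sub>M K"
proof -
  have "(\<lambda>(y, x). g x y) \<in> count_space UNIV \<Otimes>\<^sub>M M \<rightarrow>\<^sub>M K"
    by (rule measurable_pair_measure_countable1) (use assms in auto)
  then show ?thesis
    by (subst (asm) measurable_pair_swap_iff) (simp add: case_prod_beta)
qed

lemma measurable_bind_pmf_prob_space:
  assumes "countable (UNIV :: 'b set)"
    and "(\<lambda>x. measure_pmf (q x)) \<in> M \<rightarrow>\<^sub>M prob_algebra (count_space (UNIV :: 'b set))"
    and "\<And>y. (\<lambda>x. g x y) \<in> M \<rightarrow>\<^sub>M prob_algebra K"
  shows "(\<lambda>x. measure_pmf (q x) \<bind> g x) \<in> M \<rightarrow>\<^sub>M prob_algebra K"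
  using assms by (intro measurable_bind_prob_space2[where N = "count_space UNIV"] measurable_pair_count_space)

lemma measure_pmf_in_prob_algebra: "measure_pmf p \<in> space (prob_algebra (count_space UNIV))"
  by (simp add: space_prob_algebra measure_pmf.prob_space_axioms)

lemma haar_measurable_borel:
  assumes "haar_measure \<mu>"
  shows "(\<lambda>U. U) \<in> \<mu> \<rightarrow>\<^sub>M borel"
proof -
  have "(\<lambda>U. U) \<in> restrict_space borel {U. unitary U} \<rightarrow>\<^sub>M (borel :: qubit_op measure)"
    by (intro measurable_restrict_space1) simp
  then show ?thesis
    using assms by (subst measurable_cong_sets) (auto simp: haar_measure_def)
qed

lemma haar_space: "haar_measure \<mu> \<Longrightarrow> space \<mu> = {U. unitary U}"
  using sets_eq_imp_space_eq[of \<mu> "restrict_space borel {U. unitary U}"]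
  by (simp add: haar_measure_def space_restrict_space)

text \<open>The bind over the random unitary can be evaluated only if the law of the remaining
  outcomes depends measurably on the state; hence the induction treats the law as a kernel on the
  whole matrix space.\<close>

lemma measurable_outcomes:
  fixes C :: "nat \<Rightarrow> ('n::finite) clause"
  assumes \<mu>: "haar_measure \<mu>"
  shows "outcomes \<mu> C L t \<in> borel \<rightarrow>\<^sub>M prob_algebra (count_space UNIV)"
proof (induction t)
  case 0
  show ?case
    by (simp add: space_prob_algebra prob_space_return)
next
  case (Suc t)
  note [measurable] = Suc haar_measurable_borel[OF \<mu>]
  have \<mu>': "(\<lambda>\<rho>. \<mu>) \<in> borel \<rightarrow>\<^sub>M prob_algebra \<mu>"
    using \<mu> by (simp add: space_prob_algebra haar_measure_def)
  have 1: "(\<lambda>\<rho>. \<mu> \<bind> (\<lambda>U. distr (outcomes \<mu> C L t (on_qubit i U ** post1 (C \<alpha>) \<rho> ** dagger (on_qubit i U)))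
      (count_space UNIV) ((#) True))) \<in> borel \<rightarrow>\<^sub>M prob_algebra (count_space UNIV)" for i \<alpha>
    by (intro measurable_bind_prob_space2[OF \<mu>'], unfold case_prod_beta,
        intro measurable_compose[OF _ measurable_distr_prob_space[where M = "count_space UNIV"]]) measurable
  have 0: "(\<lambda>\<rho>. distr (outcomes \<mu> C L t (post0 (C \<alpha>) \<rho>)) (count_space UNIV) ((#) False))
      \<in> borel \<rightarrow>\<^sub>M prob_algebra (count_space UNIV)" for \<alpha>
    by (intro measurable_compose[OF _ measurable_distr_prob_space[where M = "count_space UNIV"]]) measurable
  have "(\<lambda>\<rho>. if b then measure_pmf (pmf_of_set {fst_qubit (C \<alpha>), snd_qubit (C \<alpha>)}) \<bind> (\<lambda>i. \<mu> \<bind> (\<lambda>U.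
        distr (outcomes \<mu> C L t (on_qubit i U ** post1 (C \<alpha>) \<rho> ** dagger (on_qubit i U)))
          (count_space UNIV) ((#) True)))
      else distr (outcomes \<mu> C L t (post0 (C \<alpha>) \<rho>)) (count_space UNIV) ((#) False))
      \<in> borel \<rightarrow>\<^sub>M prob_algebra (count_space UNIV)" for b \<alpha>
    by (cases b, simp_all only: if_True if_False 0)
      (intro measurable_bind_pmf_prob_space measurable_const measure_pmf_in_prob_algebra
        countable_finite finite 1)
  then show ?case
    unfolding outcomes.simps
    by (intro measurable_bind_pmf_prob_space measurable_const measure_pmf_in_prob_algebra
        measurable_bernoulli_pmf borel_measurable_outcome1_prob measurable_ident) auto
qed

section \<open>The outcome law as a probability measure and its recursion\<close>

lemma outcomes_prob_algebra:
  "haar_measure \<mu> \<Longrightarrow> outcomes \<mu> C L t \<rho> \<in> space (prob_algebra (count_space UNIV))"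
  using measurable_space[OF measurable_outcomes] by simp

lemma sets_outcomes: "haar_measure \<mu> \<Longrightarrow> sets (outcomes \<mu> C L t \<rho>) = sets (count_space UNIV)"
  using outcomes_prob_algebra[of \<mu> C L t \<rho>] by (simp add: space_prob_algebra)

lemma prob_space_outcomes: "haar_measure \<mu> \<Longrightarrow> prob_space (outcomes \<mu> C L t \<rho>)"
  using outcomes_prob_algebra[of \<mu> C L t \<rho>] by (simp add: space_prob_algebra)

lemma measurable_from_outcomes:
  assumes "haar_measure \<mu>" "\<And>bs. f bs \<in> space N"
  shows "f \<in> outcomes \<mu> C L t \<rho> \<rightarrow>\<^sub>M N"
  using assms by (simp add: measurable_cong_sets[OF sets_outcomes[OF assms(1)] refl])

lemma nn_integral_bind_pmf_kernel:
  assumes "\<And>x. N x \<in> space (prob_algebra (count_space UNIV))"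
  shows "(\<integral>\<^sup>+y. h y \<partial>(measure_pmf p \<bind> N)) = (\<integral>\<^sup>+x. \<integral>\<^sup>+y. h y \<partial>N x \<partial>measure_pmf p)"
  using assms
  by (intro nn_integral_bind[where B = "count_space UNIV"])
    (auto simp: space_prob_algebra space_subprob_algebra prob_space_imp_subprob_space)

lemma nn_integral_distr_outcomes:
  assumes "haar_measure \<mu>"
  shows "(\<integral>\<^sup>+bs. h bs \<partial>distr (outcomes \<mu> C L t \<rho>) (count_space UNIV) f)
    = (\<integral>\<^sup>+bs. h (f bs) \<partial>outcomes \<mu> C L t \<rho>)"
  by (rule nn_integral_distr) (simp_all add: measurable_from_outcomes[OF assms])

text \<open>First-step analysis: the nested binds of one step become a finite sum, with the Haar
  integral left inside \<open>K\<close>. Both moment bounds start from this recursion and never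
  return to the binds.\<close>

lemma nn_integral_outcomes_Suc:
  fixes C :: "nat \<Rightarrow> ('n::finite) clause" and h :: "bool list \<Rightarrow> ennreal" and t :: nat
  assumes \<mu>: "haar_measure \<mu>" and L: "L \<ge> 1"
    and C: "\<forall>\<alpha>\<in>{1..L}. is_clause (C \<alpha>)" and \<rho>: "density_op \<rho>"
  defines "K \<equiv> \<lambda>\<alpha> i. \<integral>\<^sup>+U. \<integral>\<^sup>+bs. h (True # bs)
      \<partial>outcomes \<mu> C L t (on_qubit i U ** post1 (C \<alpha>) \<rho> ** dagger (on_qubit i U)) \<partial>\<mu>"
  shows "(\<integral>\<^sup>+bs. h bs \<partial>outcomes \<mu> C L (Suc t) \<rho>) =
    (\<Sum>\<alpha>=1..L. ennreal (outcome1_prob (C \<alpha>) \<rho>) * ((K \<alpha> (fst_qubit (C \<alpha>)) + K \<alpha> (snd_qubit (C \<alpha>))) / 2)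
      + ennreal (1 - outcome1_prob (C \<alpha>) \<rho>) * (\<integral>\<^sup>+bs. h (False # bs) \<partial>outcomes \<mu> C L t (post0 (C \<alpha>) \<rho>))) / of_nat L"
proof -
  note [measurable] = measurable_outcomes[OF \<mu>, of C L t] haar_measurable_borel[OF \<mu>]
  define D1 where "D1 = (\<lambda>\<alpha> i U. distr (outcomes \<mu> C L t (on_qubit i U ** post1 (C \<alpha>) \<rho> ** dagger (on_qubit i U)))
      (count_space UNIV) ((#) True))"
  define D0 where "D0 = (\<lambda>\<alpha>. distr (outcomes \<mu> C L t (post0 (C \<alpha>) \<rho>)) (count_space UNIV) ((#) False))"
  define E where "E = (\<lambda>\<alpha> b. if b then measure_pmf (pmf_of_set {fst_qubit (C \<alpha>), snd_qubit (C \<alpha>)}) \<bind> (\<lambda>i. \<mu> \<bind> D1 \<alpha> i)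
      else D0 \<alpha>)"
  have D1: "D1 \<alpha> i \<in> \<mu> \<rightarrow>\<^sub>M prob_algebra (count_space UNIV)" for \<alpha> i
    unfolding D1_def
    by (intro measurable_compose[OF _ measurable_distr_prob_space[where M = "count_space UNIV"]]) measurable
  have \<mu>': "\<mu> \<in> space (prob_algebra \<mu>)"
    using \<mu> by (simp add: space_prob_algebra haar_measure_def)
  have \<mu>D1: "\<mu> \<bind> D1 \<alpha> i \<in> space (prob_algebra (count_space UNIV))" for \<alpha> i
    using prob_space_bind'[OF \<mu>' D1] sets_bind'[OF \<mu>' D1] by (auto simp: space_prob_algebra)
  have D0: "D0 \<alpha> \<in> space (prob_algebra (count_space UNIV))" for \<alpha>
    unfolding D0_def
    by (rule measurable_space[OF measurable_distr_prob_space[where M = "count_space UNIV"] outcomes_prob_algebra[OF \<mu>]]) simp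
  have bind: "measure_pmf p \<bind> N \<in> space (prob_algebra (count_space UNIV))"
    if "\<And>x. N x \<in> space (prob_algebra (count_space UNIV))" for p :: "'x pmf" and N :: "'x \<Rightarrow> bool list measure"
  proof -
    have "N \<in> count_space UNIV \<rightarrow>\<^sub>M prob_algebra (count_space UNIV)"
      using that by simp
    from prob_space_bind'[OF measure_pmf_in_prob_algebra this] sets_bind'[OF measure_pmf_in_prob_algebra this]
    show ?thesis by (auto simp: space_prob_algebra)
  qed
  have E: "E \<alpha> b \<in> space (prob_algebra (count_space UNIV))" for \<alpha> b
    unfolding E_def using D0 bind[OF \<mu>D1] by auto
  have intD1: "(\<integral>\<^sup>+bs. h bs \<partial>(\<mu> \<bind> D1 \<alpha> i)) = K \<alpha> i" for \<alpha> i
    unfolding K_def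
    by (subst nn_integral_bind[OF _ measurable_prob_algebraD[OF D1]])
      (simp_all add: D1_def nn_integral_distr_outcomes[OF \<mu>])
  have intE: "(\<integral>\<^sup>+bs. h bs \<partial>E \<alpha> b) = (if b then (K \<alpha> (fst_qubit (C \<alpha>)) + K \<alpha> (snd_qubit (C \<alpha>))) / 2
      else (\<integral>\<^sup>+bs. h (False # bs) \<partial>outcomes \<mu> C L t (post0 (C \<alpha>) \<rho>)))" if "\<alpha> \<in> {1..L}" for \<alpha> b
  proof -
    \<comment> \<open>Distinctness gives the set of qubits two elements, hence the mean of two
      values.\<close>
    have "fst_qubit (C \<alpha>) \<noteq> snd_qubit (C \<alpha>)" using bspec[OF C that] by (simp add: is_clause_def)
    then show ?thesis
      by (simp add: E_def D0_def nn_integral_distr_outcomes[OF \<mu>] nn_integral_bind_pmf_kernel[OF \<mu>D1]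
          intD1 nn_integral_pmf_of_set)
  qed
  have "(\<integral>\<^sup>+bs. h bs \<partial>outcomes \<mu> C L (Suc t) \<rho>) =
      (\<integral>\<^sup>+bs. h bs \<partial>(measure_pmf (pmf_of_set {1..L}) \<bind>
        (\<lambda>\<alpha>. measure_pmf (bernoulli_pmf (outcome1_prob (C \<alpha>) \<rho>)) \<bind> E \<alpha>)))"
    unfolding outcomes.simps E_def D1_def D0_def ..
  also have "\<dots> = (\<integral>\<^sup>+\<alpha>. \<integral>\<^sup>+b. \<integral>\<^sup>+bs. h bs \<partial>E \<alpha> b \<partial>measure_pmf (bernoulli_pmf (outcome1_prob (C \<alpha>) \<rho>))
      \<partial>measure_pmf (pmf_of_set {1..L}))"
    by (simp add: nn_integral_bind_pmf_kernel bind E)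
  also have "\<dots> = (\<Sum>\<alpha>=1..L. \<integral>\<^sup>+b. \<integral>\<^sup>+bs. h bs \<partial>E \<alpha> b \<partial>measure_pmf (bernoulli_pmf (outcome1_prob (C \<alpha>) \<rho>))) / of_nat L"
    using L by (simp add: nn_integral_pmf_of_set)
  also have "\<dots> = (\<Sum>\<alpha>=1..L. ennreal (outcome1_prob (C \<alpha>) \<rho>) * ((K \<alpha> (fst_qubit (C \<alpha>)) + K \<alpha> (snd_qubit (C \<alpha>))) / 2)
      + ennreal (1 - outcome1_prob (C \<alpha>) \<rho>) * (\<integral>\<^sup>+bs. h (False # bs) \<partial>outcomes \<mu> C L t (post0 (C \<alpha>) \<rho>))) / of_nat L"
  proof -
    have "(\<integral>\<^sup>+b. \<integral>\<^sup>+bs. h bs \<partial>E \<alpha> b \<partial>measure_pmf (bernoulli_pmf (outcome1_prob (C \<alpha>) \<rho>))) =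
        ennreal (outcome1_prob (C \<alpha>) \<rho>) * ((K \<alpha> (fst_qubit (C \<alpha>)) + K \<alpha> (snd_qubit (C \<alpha>))) / 2)
      + ennreal (1 - outcome1_prob (C \<alpha>) \<rho>) * (\<integral>\<^sup>+bs. h (False # bs) \<partial>outcomes \<mu> C L t (post0 (C \<alpha>) \<rho>))"
      if "\<alpha> \<in> {1..L}" for \<alpha>
      using outcome1_prob_bounds[OF bspec[OF C that] \<rho>]
      by (simp add: nn_integral_bernoulli_pmf intE[OF that] mult.commute)
    then show ?thesis
      by (intro arg_cong[where f = "\<lambda>x. x / of_nat L"] sum.cong refl)
  qed
  finally show ?thesis .
qed

section \<open>Moment bounds\<close>

lemma unitary_mult: "unitary U \<Longrightarrow> unitary V \<Longrightarrow> unitary (U ** V)"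
  unfolding unitary_def dagger_mult by (metis matrix_mul_assoc matrix_mul_lid)

lemma nn_integral_haar_left:
  assumes \<mu>: "haar_measure \<mu>" and V: "unitary V" and g [measurable]: "g \<in> borel_measurable borel"
  shows "(\<integral>\<^sup>+U. g (V ** U) \<partial>\<mu>) = (\<integral>\<^sup>+U. g U \<partial>\<mu>)"
proof -
  note [measurable] = haar_measurable_borel[OF \<mu>]
  \<comment> \<open>The sets of \<open>\<mu>\<close> are the Borel sets restricted to the unitary
    group, so measurability of the translation includes that it stays in the group.\<close>
  have "(\<lambda>U. V ** U) \<in> \<mu> \<rightarrow>\<^sub>M restrict_space borel {U. unitary U}"
    using haar_space[OF \<mu>] V unitary_mult by (intro measurable_restrict_space2) (auto, measurable)
  then have [measurable]: "(\<lambda>U. V ** U) \<in> \<mu> \<rightarrow>\<^sub>M \<mu>"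
    using \<mu> by (simp add: haar_measure_def cong: measurable_cong_sets)
  have "(\<integral>\<^sup>+U. g U \<partial>\<mu>) = (\<integral>\<^sup>+U. g U \<partial>distr \<mu> \<mu> (\<lambda>U. V ** U))"
    using \<mu> V by (simp add: haar_measure_def)
  also have "\<dots> = (\<integral>\<^sup>+U. g (V ** U) \<partial>\<mu>)"
    by (rule nn_integral_distr) measurable
  finally show ?thesis ..
qed

text \<open>By left invariance the integrals over U and over X U agree, where X is the flip, and the
  two integrands add up to the constant 2 r. The rotation U drops out because it acts on qubit
  \<open>i\<close> only, while the resampled potential involves the other qubits.\<close>

lemma
  assumes \<mu>: "haar_measure \<mu>" and B: "local_bases B" and i: "i \<in> A" and S: "psd S"
  defines "P \<equiv> potential (real (card A)) (weight B A)"
    and "r \<equiv> ex S (resampled_potential (real (card A)) (weight B (A - {i})))"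
  shows nn_integral_haar_potential:
      "(\<integral>\<^sup>+U. ennreal (ex (on_qubit i U ** S ** dagger (on_qubit i U)) P) \<partial>\<mu>) = ennreal r" (is ?integral)
    and ex_resampled_potential_nonneg: "0 \<le> r"
proof -
  note [measurable] = haar_measurable_borel[OF \<mu>]
  let ?X = "flip_op B i" and ?K = "weight B (A - {i})"
  let ?g = "\<lambda>U. ex (on_qubit i U ** S ** dagger (on_qubit i U)) P"
  have P: "P = potential (real (card A)) (?K + number_op B i)"
    unfolding P_def weight_remove[OF i, of B] ..
  have nonneg: "0 \<le> ?g U" for U
    unfolding P_def by (intro ex_potential_nonneg B psd_conj S)
  have sum: "?g U + ?g (?X ** U) = 2 * r" if U: "unitary U" for U
  proof -
    let ?S = "on_qubit i U ** S ** dagger (on_qubit i U)"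
    have X: "unitary (on_qubit i ?X)" by (intro unitary_on_qubit unitary_flip_op B)
    have "?g (?X ** U) = ex (on_qubit i ?X ** ?S ** dagger (on_qubit i ?X)) P"
      by (simp add: on_qubit_mult[symmetric] dagger_mult matrix_mul_assoc)
    then have "?g U + ?g (?X ** U) = 2 * ex ?S (resampled_potential (real (card A)) ?K)"
      unfolding P using X
      by (simp add: unitary_def potential_flip[OF _ _ _ flip_op_number_op[OF B]
            number_op_weight_commute number_op_idem[OF B]] on_qubit_weight_commute)
    also have "ex ?S (resampled_potential (real (card A)) ?K) = r"
      unfolding r_def using unitary_on_qubit[OF U, of i]
      by (intro ex_conj_commute resampled_potential_commute on_qubit_weight_commute)
        (auto simp: unitary_def)
    finally show ?thesis .
  qed
  \<comment> \<open>Evaluating \<open>sum\<close> at U = 1 writes 2 r as a sum of two nonnegative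
    terms.\<close>
  have "unitary (mat 1 :: qubit_op)" by (simp add: unitary_def)
  from sum[OF this] nonneg[of "mat 1"] nonneg[of "?X ** mat 1"] show r: "0 \<le> r" by linarith
  have "2 * (\<integral>\<^sup>+U. ennreal (?g U) \<partial>\<mu>) = (\<integral>\<^sup>+U. ennreal (?g U) \<partial>\<mu>) + (\<integral>\<^sup>+U. ennreal (?g (?X ** U)) \<partial>\<mu>)"
    by (subst nn_integral_haar_left[OF \<mu> unitary_flip_op[OF B], of "\<lambda>U. ennreal (?g U)"])
      (auto simp: mult_2)
  also have "\<dots> = (\<integral>\<^sup>+U. ennreal (?g U) + ennreal (?g (?X ** U)) \<partial>\<mu>)"
    by (rule nn_integral_add[symmetric]) measurable
  also have "\<dots> = (\<integral>\<^sup>+U. ennreal (2 * r) \<partial>\<mu>)"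
    by (intro nn_integral_cong) (simp add: haar_space[OF \<mu>] sum nonneg flip: ennreal_plus)
  also have "\<dots> = 2 * ennreal r"
    using \<mu> by (simp add: haar_measure_def prob_space.emeasure_space_1 ennreal_mult')
  finally show ?integral
    by (simp add: ennreal_mult_cancel_left)
qed

lemma ennreal_average_le:
  assumes "(\<Sum>\<alpha>=1..L. x \<alpha>) \<le> ennreal (real L * y)" "L \<ge> 1" "0 \<le> y"
  shows "(\<Sum>\<alpha>=1..L. x \<alpha>) / of_nat L \<le> ennreal y"
proof -
  have "(\<Sum>\<alpha>=1..L. x \<alpha>) / of_nat L \<le> ennreal (real L * y) / of_nat L"
    by (intro divide_right_mono_ennreal assms)
  also have "\<dots> = ennreal y"
    using assms by (simp add: divide_ennreal flip: ennreal_of_nat_eq_real_of_nat)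
      (simp add: ennreal_of_nat_eq_real_of_nat divide_ennreal)
  finally show ?thesis .
qed

lemma nn_integral_haar_le_const:
  assumes "haar_measure \<mu>" "\<And>U. unitary U \<Longrightarrow> f U \<le> c"
  shows "(\<integral>\<^sup>+U. f U \<partial>\<mu>) \<le> c"
proof -
  have "(\<integral>\<^sup>+U. f U \<partial>\<mu>) \<le> (\<integral>\<^sup>+U. c \<partial>\<mu>)"
    using assms by (intro nn_integral_mono) (simp add: haar_space)
  then show ?thesis
    using assms(1) by (simp add: haar_measure_def prob_space.emeasure_space_1)
qed

lemma half_ennreal: "0 \<le> x \<Longrightarrow> ennreal x / 2 = ennreal (x / 2)"
  by (simp add: divide_ennreal flip: ennreal_numeral)

text \<open>
  All outcome lists have length \<open>t\<close>, so that \<open>t\<close> minus the number of outcomes 0 is the number of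
  outcomes 1; written in this way, the fact about the length is not needed.
\<close>

lemma expected_outcomes_1_le:
  fixes C :: "nat \<Rightarrow> ('n::finite) clause"
  assumes \<mu>: "haar_measure \<mu>" and L: "L \<ge> 1" and B: "local_bases B"
    and C: "\<forall>\<alpha>\<in>{1..L}. is_clause (C \<alpha>)"
    and type: "\<And>\<alpha>. \<alpha> \<in> {1..L} \<Longrightarrow> type_I B (C \<alpha>) \<or> type_II B (C \<alpha>)"
    and A: "\<And>\<alpha>. \<alpha> \<in> {1..L} \<Longrightarrow> fst_qubit (C \<alpha>) \<in> A \<and> snd_qubit (C \<alpha>) \<in> A"
  defines "P \<equiv> potential (real (card A)) (weight B A)"
  shows "density_op \<rho> \<Longrightarrow>
    (\<integral>\<^sup>+bs. ennreal (real t - real (count_list bs False)) \<partial>outcomes \<mu> C L t \<rho>) \<le> ennreal (ex \<rho> P)"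
proof (induction t arbitrary: \<rho>)
  case 0
  show ?case by (simp add: nn_integral_return)
next
  case (Suc t)
  note [measurable] = haar_measurable_borel[OF \<mu>]
  let ?h = "\<lambda>t bs. ennreal (real t - real (count_list bs False))"
  let ?V = "\<lambda>i \<rho>. ex \<rho> (resampled_potential (real (card A)) (weight B (A - {i})))"
  have P_nonneg: "0 \<le> ex S P" if "psd S" for S
    unfolding P_def by (rule ex_potential_nonneg[OF B that])
  \<comment> \<open>The summand 1 pays for the outcome just recorded; the Haar average turns the
    potential of the induction hypothesis into the resampled one.\<close>
  have step1: "(\<integral>\<^sup>+U. \<integral>\<^sup>+bs. ?h (Suc t) (True # bs)
      \<partial>outcomes \<mu> C L t (on_qubit i U ** \<sigma> ** dagger (on_qubit i U)) \<partial>\<mu>) \<le> ennreal (1 + ?V i \<sigma>)"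
    if \<sigma>: "density_op \<sigma>" and i: "i \<in> A" for \<sigma> i
  proof -
    have psd: "psd \<sigma>" using \<sigma> by (simp add: density_op_iff)
    let ?\<sigma> = "\<lambda>U. on_qubit i U ** \<sigma> ** dagger (on_qubit i U)"
    have "(\<integral>\<^sup>+bs. ?h (Suc t) (True # bs) \<partial>outcomes \<mu> C L t (?\<sigma> U)) \<le> 1 + ennreal (ex (?\<sigma> U) P)"
      if "U \<in> space \<mu>" for U
    proof -
      have "(\<integral>\<^sup>+bs. ?h (Suc t) (True # bs) \<partial>outcomes \<mu> C L t (?\<sigma> U))
          \<le> (\<integral>\<^sup>+bs. 1 + ?h t bs \<partial>outcomes \<mu> C L t (?\<sigma> U))"
      proof (intro nn_integral_mono)
        fix bs
        \<comment> \<open>\<open>ennreal\<close> sends negative numbers to 0, so the 1 is split off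
          after an explicit truncation at 0.\<close>
        have "?h (Suc t) (True # bs) \<le> ennreal (1 + max 0 (real t - real (count_list bs False)))"
          by (intro ennreal_leI) simp
        also have "\<dots> = 1 + ?h t bs"
          by (simp add: ennreal_plus max_def ennreal_neg)
        finally show "?h (Suc t) (True # bs) \<le> 1 + ?h t bs" .
      qed
      also have "\<dots> = 1 + (\<integral>\<^sup>+bs. ?h t bs \<partial>outcomes \<mu> C L t (?\<sigma> U))"
        by (subst nn_integral_add)
          (auto intro!: measurable_from_outcomes[OF \<mu>] simp: prob_space.emeasure_space_1[OF prob_space_outcomes[OF \<mu>]])
      also have "\<dots> \<le> 1 + ennreal (ex (?\<sigma> U) P)"
        using that \<sigma> by (intro add_left_mono Suc.IH density_op_unitary unitary_on_qubit)
          (simp_all add: haar_space[OF \<mu>])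
      finally show ?thesis .
    qed
    then have "(\<integral>\<^sup>+U. \<integral>\<^sup>+bs. ?h (Suc t) (True # bs) \<partial>outcomes \<mu> C L t (?\<sigma> U) \<partial>\<mu>)
        \<le> (\<integral>\<^sup>+U. 1 + ennreal (ex (?\<sigma> U) P) \<partial>\<mu>)"
      by (intro nn_integral_mono)
    also have "\<dots> = 1 + ennreal (?V i \<sigma>)"
      using \<mu> by (subst nn_integral_add)
        (auto simp: P_def nn_integral_haar_potential[OF \<mu> B i psd] haar_measure_def prob_space.emeasure_space_1)
    also have "\<dots> = ennreal (1 + ?V i \<sigma>)"
      using ex_resampled_potential_nonneg[OF \<mu> B i psd] by (simp add: ennreal_plus)
    finally show ?thesis .
  qed
  have "ennreal (outcome1_prob (C \<alpha>) \<rho>) * ((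
        (\<integral>\<^sup>+U. \<integral>\<^sup>+bs. ?h (Suc t) (True # bs) \<partial>outcomes \<mu> C L t (on_qubit (fst_qubit (C \<alpha>)) U ** post1 (C \<alpha>) \<rho> ** dagger (on_qubit (fst_qubit (C \<alpha>)) U)) \<partial>\<mu>) +
        (\<integral>\<^sup>+U. \<integral>\<^sup>+bs. ?h (Suc t) (True # bs) \<partial>outcomes \<mu> C L t (on_qubit (snd_qubit (C \<alpha>)) U ** post1 (C \<alpha>) \<rho> ** dagger (on_qubit (snd_qubit (C \<alpha>)) U)) \<partial>\<mu>)) / 2)
      + ennreal (1 - outcome1_prob (C \<alpha>) \<rho>) * (\<integral>\<^sup>+bs. ?h (Suc t) (False # bs) \<partial>outcomes \<mu> C L t (post0 (C \<alpha>) \<rho>))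
      \<le> ennreal (ex \<rho> P)" (is "ennreal ?p * ((?K1 + ?K2) / 2) + _ * ?K0 \<le> _") if \<alpha>: "\<alpha> \<in> {1..L}" for \<alpha>
  proof -
    let ?F = "clause_op (C \<alpha>)" and ?i = "fst_qubit (C \<alpha>)" and ?j = "snd_qubit (C \<alpha>)"
    have F: "dagger ?F = ?F" "?F ** ?F = ?F"
      using bspec[OF C \<alpha>] by (simp_all add: dagger_clause_op clause_op_idem)
    have psd: "psd \<rho>" using Suc.prems by (simp add: density_op_iff)
    let ?S1 = "?F ** \<rho> ** ?F" and ?S0 = "(mat 1 - ?F) ** \<rho> ** (mat 1 - ?F)"
    have psd1: "psd ?S1" using psd_conj[OF psd, of ?F] F by simp
    have psd0: "psd ?S0" using psd_conj[OF psd, of "mat 1 - ?F"] F by (simp add: dagger_diff)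
    have p: "0 \<le> ?p" "?p \<le> 1"
      using outcome1_prob_bounds[OF bspec[OF C \<alpha>] Suc.prems] .
    have A': "?i \<in> A" "?j \<in> A" using A[OF \<alpha>] by auto
    \<comment> \<open>For \<open>?p = 0\<close> the post-measurement state is the zero matrix, to
      which the induction hypothesis does not apply; there the factor \<open>?p\<close> settles the
      claim.\<close>
    have "ennreal ?p * ((?K1 + ?K2) / 2) \<le> ennreal (ex ?S1 P)"
    proof (cases "?p = 0")
      case False
      let ?\<sigma> = "post1 (C \<alpha>) \<rho>"
      have \<sigma>: "density_op ?\<sigma>"
        by (rule density_op_post1[OF bspec[OF C \<alpha>] Suc.prems False])
      have S1: "?S1 = ?p *\<^sub>R ?\<sigma>"
        using False by (simp add: post1_def)
      have V: "0 \<le> ?V ?i ?\<sigma>" "0 \<le> ?V ?j ?\<sigma>"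
        using \<sigma> A' by (auto intro!: ex_resampled_potential_nonneg[OF \<mu> B] simp: density_op_iff)
      have "(?K1 + ?K2) / 2 \<le> (ennreal (1 + ?V ?i ?\<sigma>) + ennreal (1 + ?V ?j ?\<sigma>)) / 2"
        by (intro divide_right_mono_ennreal add_mono step1 \<sigma> A')
      also have "\<dots> = ennreal ((?V ?i ?\<sigma> + ?V ?j ?\<sigma>) / 2 + 1)"
        using V by (simp add: half_ennreal field_simps flip: ennreal_plus)
      finally have "ennreal ?p * ((?K1 + ?K2) / 2) \<le> ennreal (?p * ((?V ?i ?\<sigma> + ?V ?j ?\<sigma>) / 2 + 1))"
        using p by (simp add: ennreal_mult' mult_left_mono)
      also have "\<dots> \<le> ennreal (ex ?S1 P)"
      proof (intro ennreal_leI)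
        \<comment> \<open>Multiplying by \<open>?p\<close> returns to the unnormalised state, whose
          trace \<open>?p\<close> is the drop that the clause guarantees.\<close>
        have "ex ?\<sigma> (mat 1) = 1" using \<sigma> by (simp add: density_op_iff ex_def)
        then show "?p * ((?V ?i ?\<sigma> + ?V ?j ?\<sigma>) / 2 + 1) \<le> ex ?S1 P"
          using potential_clause_decrease(1)[OF B bspec[OF C \<alpha>] type[OF \<alpha>] A' psd]
          by (simp add: S1 P_def ex_scaleR_state algebra_simps add_divide_distrib)
      qed
      finally show ?thesis .
    qed simp
    moreover have "ennreal (1 - ?p) * ?K0 \<le> ennreal (ex ?S0 P)"
    proof (cases "?p = 1")
      case False
      let ?\<sigma> = "post0 (C \<alpha>) \<rho>"
      have \<sigma>: "density_op ?\<sigma>"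
        by (rule density_op_post0[OF bspec[OF C \<alpha>] Suc.prems False])
      have S0: "?S0 = (1 - ?p) *\<^sub>R ?\<sigma>"
        using False by (simp add: post0_def)
      have "?K0 \<le> ennreal (ex ?\<sigma> P)"
        using Suc.IH[OF \<sigma>] by simp
      then show ?thesis
        using p unfolding S0 ex_scaleR_state by (simp add: ennreal_mult' mult_left_mono)
    qed simp
    ultimately have "ennreal ?p * ((?K1 + ?K2) / 2) + ennreal (1 - ?p) * ?K0 \<le> ennreal (ex ?S1 P) + ennreal (ex ?S0 P)"
      by (rule add_mono)
    also have "\<dots> = ennreal (ex \<rho> P)"
      using ex_measurement[OF F, of P \<rho>] potential_clause_decrease(2)[OF B bspec[OF C \<alpha>] type[OF \<alpha>] A' psd]
      by (simp add: P_nonneg psd1 psd0 P_def[symmetric] flip: ennreal_plus)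
    finally show ?thesis .
  qed
  note sum_mono[where K = "{1..L}", OF this]
  also have "(\<Sum>\<alpha>=1..L. ennreal (ex \<rho> P)) = ennreal (real L * ex \<rho> P)"
    using Suc.prems by (simp add: P_nonneg density_op_iff ennreal_mult' ennreal_of_nat_eq_real_of_nat)
  finally show ?case
    unfolding nn_integral_outcomes_Suc[OF \<mu> L C Suc.prems]
    using L Suc.prems by (intro ennreal_average_le) (auto simp: P_nonneg density_op_iff)
qed

text \<open>\<open>r\<close> is the moment generating function at \<open>s\<close> of a variable
  equal to 1 with probability 1 - c / L and to 0 otherwise. One step contributes the mean of p + (1
  - p) e^s, which decreases in p; as this holds from every state, the induction replaces
  independence.\<close>

lemma exp_outcomes_0_le:
  fixes C :: "nat \<Rightarrow> ('n::finite) clause"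
  assumes \<mu>: "haar_measure \<mu>" and L: "L \<ge> 1"
    and C: "\<forall>\<alpha>\<in>{1..L}. is_clause (C \<alpha>)"
    and no: "no_instance c C L" and s: "0 \<le> s"
  defines "r \<equiv> exp s - (exp s - 1) * (c / real L)"
  shows "density_op \<rho> \<Longrightarrow>
    (\<integral>\<^sup>+bs. ennreal (exp (s * real (count_list bs False))) \<partial>outcomes \<mu> C L t \<rho>) \<le> ennreal (r ^ t)"
proof (induction t arbitrary: \<rho>)
  case 0
  show ?case by (simp add: nn_integral_return)
next
  case (Suc t)
  let ?h = "\<lambda>bs. ennreal (exp (s * real (count_list bs False)))"
  let ?p = "\<lambda>\<alpha>. outcome1_prob (C \<alpha>) \<rho>"
  have p: "0 \<le> ?p \<alpha>" "?p \<alpha> \<le> 1" if "\<alpha> \<in> {1..L}" for \<alpha>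
    using outcome1_prob_bounds[OF bspec[OF C that] Suc.prems] .
  \<comment> \<open>The same sum of probabilities forces c \<le> L, which keeps \<open>r\<close>
    nonnegative.\<close>
  have c: "c \<le> (\<Sum>\<alpha>=1..L. ?p \<alpha>)"
    by (rule no_instance_outcome1_prob[OF no Suc.prems])
  also have "\<dots> \<le> real L"
    using sum_bounded_above[of "{1..L}" ?p 1] p by simp
  finally have "c / real L \<le> 1" using L by simp
  then have "(exp s - 1) * (c / real L) \<le> (exp s - 1) * 1"
    using s by (intro mult_left_mono) auto
  then have r: "0 \<le> r" by (simp add: r_def)
  have "ennreal (?p \<alpha>) * ((
        (\<integral>\<^sup>+U. \<integral>\<^sup>+bs. ?h (True # bs) \<partial>outcomes \<mu> C L t (on_qubit (fst_qubit (C \<alpha>)) U ** post1 (C \<alpha>) \<rho> ** dagger (on_qubit (fst_qubit (C \<alpha>)) U)) \<partial>\<mu>) +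
        (\<integral>\<^sup>+U. \<integral>\<^sup>+bs. ?h (True # bs) \<partial>outcomes \<mu> C L t (on_qubit (snd_qubit (C \<alpha>)) U ** post1 (C \<alpha>) \<rho> ** dagger (on_qubit (snd_qubit (C \<alpha>)) U)) \<partial>\<mu>)) / 2)
      + ennreal (1 - ?p \<alpha>) * (\<integral>\<^sup>+bs. ?h (False # bs) \<partial>outcomes \<mu> C L t (post0 (C \<alpha>) \<rho>))
      \<le> ennreal ((?p \<alpha> + (1 - ?p \<alpha>) * exp s) * r ^ t)"
    (is "_ * ((?K1 + ?K2) / 2) + _ * ?K0 \<le> _") if \<alpha>: "\<alpha> \<in> {1..L}" for \<alpha>
  proof -
    have "ennreal (?p \<alpha>) * ((?K1 + ?K2) / 2) \<le> ennreal (?p \<alpha> * r ^ t)"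
    proof (cases "?p \<alpha> = 0")
      case False
      have \<sigma>: "density_op (post1 (C \<alpha>) \<rho>)"
        by (rule density_op_post1[OF bspec[OF C \<alpha>] Suc.prems False])
      have "(?K1 + ?K2) / 2 \<le> (ennreal (r ^ t) + ennreal (r ^ t)) / 2"
        using Suc.IH[OF density_op_unitary[OF \<sigma> unitary_on_qubit]]
        by (intro divide_right_mono_ennreal add_mono nn_integral_haar_le_const[OF \<mu>]) simp_all
      also have "\<dots> = ennreal (r ^ t)"
        using r by (simp add: half_ennreal flip: ennreal_plus)
      finally show ?thesis
        using p[OF \<alpha>] by (simp add: ennreal_mult' mult_left_mono)
    qed simp
    moreover have "ennreal (1 - ?p \<alpha>) * ?K0 \<le> ennreal ((1 - ?p \<alpha>) * exp s * r ^ t)"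
    proof (cases "?p \<alpha> = 1")
      case False
      have \<sigma>: "density_op (post0 (C \<alpha>) \<rho>)"
        by (rule density_op_post0[OF bspec[OF C \<alpha>] Suc.prems False])
      have "?K0 = ennreal (exp s) * (\<integral>\<^sup>+bs. ?h bs \<partial>outcomes \<mu> C L t (post0 (C \<alpha>) \<rho>))"
        by (subst nn_integral_cmult[symmetric])
          (auto intro!: measurable_from_outcomes[OF \<mu>] simp: exp_add distrib_left ennreal_mult' mult.commute)
      also have "\<dots> \<le> ennreal (exp s) * ennreal (r ^ t)"
        by (intro mult_left_mono Suc.IH \<sigma>) simp
      finally show ?thesis
        using p[OF \<alpha>] by (simp add: ennreal_mult' mult_left_mono mult.assoc)
    qed simp
    ultimately have "ennreal (?p \<alpha>) * ((?K1 + ?K2) / 2) + ennreal (1 - ?p \<alpha>) * ?K0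
        \<le> ennreal (?p \<alpha> * r ^ t) + ennreal ((1 - ?p \<alpha>) * exp s * r ^ t)"
      by (rule add_mono)
    also have "\<dots> = ennreal ((?p \<alpha> + (1 - ?p \<alpha>) * exp s) * r ^ t)"
      using p[OF \<alpha>] r by (simp add: distrib_right flip: ennreal_plus)
    finally show ?thesis .
  qed
  then have "(\<Sum>\<alpha>=1..L. ennreal (?p \<alpha>) * ((
        (\<integral>\<^sup>+U. \<integral>\<^sup>+bs. ?h (True # bs) \<partial>outcomes \<mu> C L t (on_qubit (fst_qubit (C \<alpha>)) U ** post1 (C \<alpha>) \<rho> ** dagger (on_qubit (fst_qubit (C \<alpha>)) U)) \<partial>\<mu>) +
        (\<integral>\<^sup>+U. \<integral>\<^sup>+bs. ?h (True # bs) \<partial>outcomes \<mu> C L t (on_qubit (snd_qubit (C \<alpha>)) U ** post1 (C \<alpha>) \<rho> ** dagger (on_qubit (snd_qubit (C \<alpha>)) U)) \<partial>\<mu>)) / 2)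
      + ennreal (1 - ?p \<alpha>) * (\<integral>\<^sup>+bs. ?h (False # bs) \<partial>outcomes \<mu> C L t (post0 (C \<alpha>) \<rho>)))
      \<le> (\<Sum>\<alpha>=1..L. ennreal ((?p \<alpha> + (1 - ?p \<alpha>) * exp s) * r ^ t))"
    by (rule sum_mono)
  also have "\<dots> = ennreal (\<Sum>\<alpha>=1..L. (?p \<alpha> + (1 - ?p \<alpha>) * exp s) * r ^ t)"
    using p r by (intro sum_ennreal) auto
  also have "\<dots> \<le> ennreal (real L * r ^ Suc t)"
  proof (intro ennreal_leI)
    have "(\<Sum>\<alpha>=1..L. ?p \<alpha> + (1 - ?p \<alpha>) * exp s) = real L * exp s - (exp s - 1) * (\<Sum>\<alpha>=1..L. ?p \<alpha>)"
      by (simp add: sum.distrib sum_subtractf sum_distrib_left[symmetric] sum_distrib_right[symmetric] algebra_simps)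
    also have "\<dots> \<le> real L * exp s - (exp s - 1) * c"
      using c s by (intro diff_left_mono mult_left_mono) auto
    also have "\<dots> = real L * r"
      using L by (simp add: r_def field_simps)
    finally show "(\<Sum>\<alpha>=1..L. (?p \<alpha> + (1 - ?p \<alpha>) * exp s) * r ^ t) \<le> real L * r ^ Suc t"
      using r by (simp add: sum_distrib_right[symmetric] mult_right_mono mult.assoc[symmetric])
  qed
  finally show ?case
    unfolding nn_integral_outcomes_Suc[OF \<mu> L C Suc.prems]
    using r L by (intro ennreal_average_le) auto
qed

section \<open>Tail bounds\<close>

text \<open>With y = f L the quadratic part of T cancels, since y^2 - (y - 1)^3 / y = 3 y - 3 + 1 /
  y; for fixed n the difference grows only linearly in y.\<close>

lemma cutoff_eq:
  assumes "T = 5 * y\<^sup>2 * n\<^sup>2 / 2" "N = T * ((y - 1) / y) ^ 3 - 2 * y * n" "y \<ge> (1::real)"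
  shows "T - N = 5 / 2 * n\<^sup>2 * (3 * y - 3 + 1 / y) + 2 * y * n"
  unfolding assms(2) assms(1) using assms(3)
  by (simp add: power2_eq_square power3_eq_cube field_simps)

text \<open>6 m^2 is three times the bound 2 m^2 on the expected number of outcomes 1, so Markov's
  inequality gives failure probability at most 1/3. For \<open>N \<le> 0\<close> the event is the
  whole space.\<close>

lemma outcomes_yes:
  fixes C :: "nat \<Rightarrow> ('n::finite) clause" and N :: real
  assumes \<mu>: "haar_measure \<mu>" and L: "L \<ge> 1" and B: "local_bases B"
    and C: "\<forall>\<alpha>\<in>{1..L}. is_clause (C \<alpha>)"
    and type: "\<And>\<alpha>. \<alpha> \<in> {1..L} \<Longrightarrow> type_I B (C \<alpha>) \<or> type_II B (C \<alpha>)"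
    and A: "\<And>\<alpha>. \<alpha> \<in> {1..L} \<Longrightarrow> fst_qubit (C \<alpha>) \<in> A \<and> snd_qubit (C \<alpha>) \<in> A"
    and \<rho>: "density_op \<rho>" and N: "N \<le> 0 \<or> 6 * (real (card A))\<^sup>2 \<le> real t - N"
  shows "measure (outcomes \<mu> C L t \<rho>) {bs. real (count_list bs False) \<ge> N} \<ge> 2 / 3"
proof -
  let ?M = "outcomes \<mu> C L t \<rho>" and ?m = "real (card A)"
  interpret prob_space ?M by (rule prob_space_outcomes[OF \<mu>])
  note M = sets_outcomes[OF \<mu>, of C L t \<rho>]
  have space: "space ?M = UNIV" using sets_eq_imp_space_eq[OF M] by simp
  show ?thesis
  proof (cases "N \<le> 0")
    case True
    then have "{bs. real (count_list bs False) \<ge> N} = space ?M" by (auto simp: space)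
    then show ?thesis by (simp only: prob_space)
  next
    case False
    define a where "a = real t - N"
    \<comment> \<open>A clause exists, so \<open>A\<close> is nonempty and the threshold
      \<open>a\<close> is a positive divisor.\<close>
    have "fst_qubit (C 1) \<in> A" using A[of 1] L by simp
    then have "0 < card A" by (auto simp: card_gt_0_iff)
    then have "0 < 6 * ?m\<^sup>2" by (auto simp: card_gt_0_iff)
    with N False have a: "6 * ?m\<^sup>2 \<le> a" "0 < a"
      unfolding a_def by linarith+
    let ?E = "{bs. real (count_list bs False) < N}"
    have "emeasure ?M ?E = (\<integral>\<^sup>+bs. indicator ?E bs \<partial>?M)"
      by (simp add: M)
    also have "\<dots> \<le> (\<integral>\<^sup>+bs. ennreal (1 / a) * ennreal (real t - real (count_list bs False)) \<partial>?M)"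
    proof (intro nn_integral_mono)
      fix bs
      have "indicator ?E bs = ennreal (if bs \<in> ?E then 1 else 0)" by simp
      also have "\<dots> \<le> ennreal (max 0 ((real t - real (count_list bs False)) / a))"
        using a by (intro ennreal_leI) (auto simp: a_def)
      also have "\<dots> = ennreal ((real t - real (count_list bs False)) / a)"
        by (simp add: max_def ennreal_neg)
      finally show "indicator ?E bs \<le> ennreal (1 / a) * ennreal (real t - real (count_list bs False))"
        using a by (simp flip: ennreal_mult')
    qed
    also have "\<dots> = ennreal (1 / a) * (\<integral>\<^sup>+bs. ennreal (real t - real (count_list bs False)) \<partial>?M)"
      by (rule nn_integral_cmult) (simp add: measurable_from_outcomes[OF \<mu>])
    also have "\<dots> \<le> ennreal (1 / a) * ennreal (ex \<rho> (potential ?m (weight B A)))"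
      by (intro mult_left_mono expected_outcomes_1_le[OF \<mu> L B C type A \<rho>]) auto
    also have "\<dots> \<le> ennreal (1 / a) * ennreal (2 * ?m\<^sup>2)"
      using ex_potential_le[of \<rho> "weight B A" ?m] \<rho>
      by (intro mult_left_mono ennreal_leI) (auto simp: density_op_iff dagger_weight ex_def)
    also have "\<dots> \<le> ennreal (1 / 3)"
      using a by (simp add: field_simps flip: ennreal_mult')
    finally have "prob ?E \<le> 1 / 3"
      by (simp add: emeasure_eq_measure)
    moreover have "{bs. real (count_list bs False) \<ge> N} = space ?M - ?E"
      by (auto simp: space)
    ultimately show ?thesis
      by (simp only:) (subst prob_compl, auto simp: M)
  qed
qed

text \<open>One factor of the Chernoff bound at s = 1/5, with q = c / L. The constant 9/50 bounds 1
  - e^(-1/5) from below: e^(1/5) \<ge> 61/50, and 41/50 times 61/50 is just above 1.\<close>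

lemma exp_decay_bound:
  assumes "0 \<le> q" "q \<le> 1"
  shows "exp (1/5) - (exp (1/5) - 1) * q \<le> exp (1/5 - 9 / 50 * q :: real)"
proof -
  have "1 + 1/5 + (1/5)\<^sup>2 / 2 \<le> exp (1/5 :: real)"
    by (rule exp_lower_Taylor_quadratic) simp
  then have "1 \<le> 41/50 * exp (1/5 :: real)" by (simp add: power2_eq_square)
  then have "9/50 * exp (1/5 :: real) * q \<le> (exp (1/5) - 1) * q"
    using assms by (intro mult_right_mono) auto
  then have "exp (1/5) - (exp (1/5) - 1) * q \<le> exp (1/5) * (1 + (- (9 / 50 * q)))"
    by (simp add: algebra_simps)
  also have "\<dots> \<le> exp (1/5) * exp (- (9/50 * q))"
    by (intro mult_left_mono exp_ge_add_one_self) simp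
  also have "\<dots> = exp (1/5 - 9 / 50 * q)"
    by (simp flip: exp_add)
  finally show ?thesis .
qed

text \<open>Exponential Markov inequality with parameter 1/5. The left side of the assumption on
  \<open>N\<close> is the exponent that results from e^(-N/5) r^t and
  \<open>exp_decay_bound\<close>; e^(-4) \<le> 1/5 is more than enough.\<close>

lemma outcomes_no:
  fixes C :: "nat \<Rightarrow> ('n::finite) clause" and N :: real
  assumes \<mu>: "haar_measure \<mu>" and L: "L \<ge> 1"
    and C: "\<forall>\<alpha>\<in>{1..L}. is_clause (C \<alpha>)"
    and no: "no_instance c C L" and c: "0 < c" and \<rho>: "density_op \<rho>"
    and N: "(real t - N) / 5 - 9 / 50 * (real t * c / real L) \<le> - 4"
  shows "measure (outcomes \<mu> C L t \<rho>) {bs. real (count_list bs False) > N} \<le> 1 / 3"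
proof -
  let ?M = "outcomes \<mu> C L t \<rho>" and ?E = "{bs. real (count_list bs False) > N}"
  interpret prob_space ?M by (rule prob_space_outcomes[OF \<mu>])
  note M = sets_outcomes[OF \<mu>, of C L t \<rho>]
  let ?q = "c / real L"
  have "c \<le> (\<Sum>\<alpha>=1..L. outcome1_prob (C \<alpha>) \<rho>)"
    by (rule no_instance_outcome1_prob[OF no \<rho>])
  also have "\<dots> \<le> real L"
    using sum_mono[of "{1..L}" "\<lambda>\<alpha>. outcome1_prob (C \<alpha>) \<rho>" "\<lambda>_. 1"]
      outcome1_prob_bounds(2)[OF bspec[OF C] \<rho>] by simp
  finally have q: "0 \<le> ?q" "?q \<le> 1" using L c by auto
  let ?r = "exp (1/5) - (exp (1/5) - 1) * ?q"
  have "(exp (1/5) - 1) * ?q \<le> (exp (1/5) - 1) * 1"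
    using q by (intro mult_left_mono) auto
  then have r: "0 \<le> ?r" by simp
  have "emeasure ?M ?E = (\<integral>\<^sup>+bs. indicator ?E bs \<partial>?M)"
    by (simp add: M)
  also have "\<dots> \<le> (\<integral>\<^sup>+bs. ennreal (exp (- N / 5)) * ennreal (exp (1/5 * real (count_list bs False))) \<partial>?M)"
  proof (intro nn_integral_mono)
    fix bs
    have "indicator ?E bs = ennreal (if bs \<in> ?E then 1 else 0)" by simp
    also have "\<dots> \<le> ennreal (exp (- N / 5 + 1/5 * real (count_list bs False)))"
      by (intro ennreal_leI) auto
    finally show "indicator ?E bs \<le> ennreal (exp (- N / 5)) * ennreal (exp (1/5 * real (count_list bs False)))"
      by (simp only: exp_add ennreal_mult' exp_ge_zero)
  qed
  also have "\<dots> = ennreal (exp (- N / 5)) * (\<integral>\<^sup>+bs. ennreal (exp (1/5 * real (count_list bs False))) \<partial>?M)"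
    by (rule nn_integral_cmult) (simp add: measurable_from_outcomes[OF \<mu>])
  also have "\<dots> \<le> ennreal (exp (- N / 5)) * ennreal (?r ^ t)"
    by (intro mult_left_mono exp_outcomes_0_le[OF \<mu> L C no _ \<rho>]) auto
  also have "\<dots> \<le> ennreal (exp (- N / 5)) * ennreal (exp (1/5 - 9 / 50 * ?q) ^ t)"
    using q r by (intro mult_left_mono ennreal_leI power_mono exp_decay_bound) auto
  also have "\<dots> = ennreal (exp ((real t - N) / 5 - 9 / 50 * (real t * c / real L)))"
    by (simp add: algebra_simps diff_divide_distrib flip: ennreal_mult' exp_add exp_of_nat_mult)
  also have "\<dots> \<le> ennreal (exp (- 4))"
    using N by (intro ennreal_leI) simp
  finally have "prob ?E \<le> exp (- 4)"
    by (simp add: emeasure_eq_measure)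
  also have "\<dots> \<le> (1 / 3 :: real)"
    using exp_ge_add_one_self[of 4] by (simp add: exp_minus field_simps)
  finally show ?thesis .
qed

theorem mainTheorem6:
  fixes C :: "nat \<Rightarrow> ('n::finite) clause"
    and \<mu> :: "qubit_op measure"
    and n L T :: nat
    and c f N :: real
  assumes "n = CARD('n)" and "n \<ge> 2" and "L \<ge> 1" and "c > 0"
    and "f = max (22 / (5 * c)) 1"
    and "real T = 5 * f\<^sup>2 * (real L)\<^sup>2 * (real n)\<^sup>2 / 2"
    and "N = real T * ((f * real L - 1) / (f * real L)) ^ 3 - 2 * f * real L * real n"
    and "\<forall>\<alpha>\<in>{1..L}. is_clause (C \<alpha>)"
    and "haar_measure \<mu>"
  shows "(yes_instance C L \<and>
          (\<exists>B. local_bases B \<and> (\<forall>\<alpha>\<in>{1..L}. type_I B (C \<alpha>) \<or> type_II B (C \<alpha>))) \<longrightarrow>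
            measure (outcomes \<mu> C L T maximally_mixed)
              {bs. real (count_list bs False) \<ge> N} \<ge> 2 / 3) \<and>
         (no_instance c C L \<longrightarrow>
            measure (outcomes \<mu> C L T maximally_mixed)
              {bs. real (count_list bs False) > N} \<le> 1 / 3)"
proof -
  define y where "y = f * real L"
  have "1 * 1 \<le> f * real L" using assms(3,5) by (intro mult_mono) auto
  then have y: "1 \<le> y" by (simp add: y_def)
  have T: "real T = 5 * y\<^sup>2 * (real n)\<^sup>2 / 2"
    using assms(6) by (simp add: y_def power_mult_distrib)
  have N: "N = real T * ((y - 1) / y) ^ 3 - 2 * y * real n"
    using assms(7) by (simp add: y_def)
  note TN = cutoff_eq[OF T N y]
  have "0 \<le> (real n - 2) * (real n + 2)" using assms(2) by (intro mult_nonneg_nonneg) auto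
  then have n4: "4 \<le> (real n)\<^sup>2" by (simp add: power2_eq_square algebra_simps)
  have yn: "0 \<le> 2 * y * real n" using y by simp
  \<comment> \<open>These are the two situations covered by \<open>outcomes_yes\<close>.\<close>
  have "N \<le> 0 \<or> (\<exists>A :: 'n set. (\<forall>\<alpha>\<in>{1..L}. fst_qubit (C \<alpha>) \<in> A \<and> snd_qubit (C \<alpha>) \<in> A)
      \<and> 6 * (real (card A))\<^sup>2 \<le> real T - N)"
  proof (cases "L = 1")
    case False
    \<comment> \<open>For L \<ge> 2 the bracket in \<open>TN\<close> is at least 3, and 15/2 exceeds
      6.\<close>
    have "1 * 2 \<le> f * real L" using False assms(3,5) by (intro mult_mono) auto
    then have y2: "2 \<le> y" by (simp add: y_def)
    have "0 \<le> 1 / y" using y by simp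
    with y2 have "5 / 2 * (real n)\<^sup>2 * 3 \<le> 5 / 2 * (real n)\<^sup>2 * (3 * y - 3 + 1 / y)"
      by (intro mult_left_mono) (linarith, simp)
    then have "6 * (real n)\<^sup>2 \<le> real T - N" using TN yn n4 by linarith
    then show ?thesis by (intro disjI2 exI[of _ UNIV]) (simp add: assms(1))
  next
    case True
    \<comment> \<open>\<open>f L\<close> may be close to 1 here, so that \<open>6 n\<^sup>2\<close> exceeds \<open>T - N\<close>; but only two qubits matter.\<close>
    let ?A = "{fst_qubit (C 1), snd_qubit (C 1)}"
    have "card ?A = 2" using assms(8) True by (simp add: is_clause_def)
    then have A: "\<exists>A :: 'n set. (\<forall>\<alpha>\<in>{1..L}. fst_qubit (C \<alpha>) \<in> A \<and> snd_qubit (C \<alpha>) \<in> A)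
      \<and> 6 * (real (card A))\<^sup>2 \<le> real T - N" if "24 \<le> real T - N"
      using True that by (intro exI[of _ ?A]) auto
    \<comment> \<open>The bracket minus 1 factors as (3 y - 1) (y - 1) / y.\<close>
    have g: "1 \<le> 3 * y - 3 + 1 / y"
    proof -
      have "0 \<le> (3 * y - 1) * (y - 1) / y" using y by simp
      also have "\<dots> = 3 * y - 3 + 1 / y - 1" using y by (simp add: field_simps)
      finally show ?thesis by simp
    qed
    show ?thesis
    proof (cases "n = 2")
      case False
      then have n: "3 \<le> real n" using assms(2) by simp
      then have "3 * 3 \<le> real n * real n" by (intro mult_mono) auto
      \<comment> \<open>For n \<ge> 3 this gives T - N \<ge> 45/2 + 6, above the required 24 = 6 *
        2^2.\<close>
      then have "9 * 1 \<le> (real n)\<^sup>2 * (3 * y - 3 + 1 / y)"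
        using g by (intro mult_mono) (auto simp: power2_eq_square)
      moreover have "1 * 3 \<le> y * real n" using y n by (intro mult_mono) auto
      ultimately have "24 \<le> real T - N" using TN by linarith
      with A show ?thesis by blast
    next
      case n2: True
      show ?thesis
      \<comment> \<open>For n = 2, T - N = 34 y - 30 + 10 / y is only 14 at y = 1, but there N = 10
        (y - 1)^3 / y - 4 y is negative. At 8/5 both arguments work: 10 (3/5)^3 < 4 and 34 * 8/5 >
        54.\<close>
      proof (cases "y \<le> 8 / 5")
        case True
        have "N = 10 * (y - 1) ^ 3 / y - 4 * y"
          unfolding N T n2 using y by (simp add: power2_eq_square power3_eq_cube field_simps)
        moreover have "10 * (y - 1) ^ 3 / y \<le> 4 * y"
        proof -
          have "(y - 1) ^ 3 \<le> (3 / 5) ^ 3" using True y by (intro power_mono) auto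
          moreover have "1 * 1 \<le> y * y" using y by (intro mult_mono) auto
          ultimately have "10 * (y - 1) ^ 3 \<le> 4 * (y * y)" by (simp add: power3_eq_cube)
          then show ?thesis using y by (simp add: field_simps)
        qed
        ultimately show ?thesis by simp
      next
        case False
        have "0 \<le> 10 / y" using y by simp
        with False have "54 \<le> 34 * y + 10 / y" by linarith
        then have "24 \<le> real T - N"
          unfolding TN n2 by simp
        with A show ?thesis by blast
      qed
    qed
  qed
  then have yes: "measure (outcomes \<mu> C L T maximally_mixed) {bs. real (count_list bs False) \<ge> N} \<ge> 2 / 3"
    if "local_bases B" "\<forall>\<alpha>\<in>{1..L}. type_I B (C \<alpha>) \<or> type_II B (C \<alpha>)" for B
  proof (elim disjE exE conjE)
    assume "N \<le> 0"
    then show ?thesis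
      using that by (intro outcomes_yes[OF assms(9,3) that(1) assms(8), of UNIV] density_op_maximally_mixed) auto
  next
    fix A :: "'n set"
    assume "\<forall>\<alpha>\<in>{1..L}. fst_qubit (C \<alpha>) \<in> A \<and> snd_qubit (C \<alpha>) \<in> A" "6 * (real (card A))\<^sup>2 \<le> real T - N"
    then show ?thesis
      using that by (intro outcomes_yes[OF assms(9,3) that(1) assms(8), of A] density_op_maximally_mixed) auto
  qed
  have no: "measure (outcomes \<mu> C L T maximally_mixed) {bs. real (count_list bs False) > N} \<le> 1 / 3"
    if "no_instance c C L"
  proof (rule outcomes_no[OF assms(9,3,8) that assms(4) density_op_maximally_mixed])
    \<comment> \<open>\<open>D\<close> is the common scale and \<open>X\<close> the lower bound for
      the expected number of outcomes 1. Here 22/5 enters: X = (5/2) D f c \<ge> 11 D.\<close>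
    define D where "D = y * (real n)\<^sup>2"
    define X where "X = real T * c / real L"
    have "22 / (5 * c) * c \<le> f * c" using assms(4,5) by (intro mult_right_mono) auto
    then have fc: "22 / 5 \<le> f * c" using assms(4) by (simp add: field_simps)
    have "X = 5 / 2 * D * (f * c)"
      using assms(3) by (simp add: X_def T D_def y_def power2_eq_square)
    moreover have "0 \<le> D" using y by (simp add: D_def)
    moreover from this have "5 / 2 * D * (22 / 5) \<le> 5 / 2 * D * (f * c)"
      using fc by (intro mult_left_mono) auto
    ultimately have 1: "11 * D \<le> X" by linarith
    have "1 / y \<le> 1" using y by simp
    then have "5 / 2 * (real n)\<^sup>2 * (3 * y - 3 + 1 / y) \<le> 5 / 2 * (real n)\<^sup>2 * (3 * y - 3 + 1)"
      by (intro mult_left_mono) auto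
    also have "\<dots> = 15 / 2 * D - 5 * (real n)\<^sup>2"
      by (simp add: D_def field_simps)
    finally have "real T - N \<le> 15 / 2 * D - 5 * (real n)\<^sup>2 + 2 * y * real n"
      using TN by simp
    moreover have "2 * y * real n \<le> D"
      using mult_left_mono[of 2 "real n" "y * real n"] assms(2) y by (simp add: D_def power2_eq_square mult_ac)
    \<comment> \<open>The 20 comes from 5 n^2 with n \<ge> 2. The exponent is then at most (17/10) D
      - 4 - (99/50) D = -(7/25) D - 4.\<close>
    ultimately have "real T - N \<le> 17 / 2 * D - 20" using n4 by argo
    then show "(real T - N) / 5 - 9 / 50 * (real T * c / real L) \<le> - 4"
      using 1 \<open>0 \<le> D\<close> unfolding X_def[symmetric] by argo
  qed
  show ?thesis using yes no by blast
qed

end
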